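(* Let $g\ge2$ and $\gamma\in\Gamma_g$. If $\gamma\notin[\Gamma_g,\Gamma_g]$ then there exists $n_0=n_0(\gamma)$ such that for all $n\ge n_0$, $\mathbb{E}_{g,n}[\mathrm{tr}_\gamma]=0$.
   Context: For $g\ge 2$ let $\Gamma_g=\langle a_1,b_1,\ldots,a_g,b_g\mid [a_1,b_1]\cdots[a_g,b_g]\rangle$, $[x,y]=xyx^{-1}y^{-1}$ (the fundamental group of a closed orientable surface of genus $g$); $[\Gamma_g,\Gamma_g]$ is its commutator subgroup. $\mathrm{Hom}(\Gamma_g,\mathrm{SU}(n))$ is viewed inside $\mathrm{SU}(n)^{2g}$ via $\phi\mapsto(\phi(a_1),\phi(b_1),\ldots,\phi(a_g),\phi(b_g))$. $\mathrm{Hom}(\Gamma_g,\mathrm{SU}(n))^{\mathrm{irr}}$ is the set of $\phi$ that are irreducible as linear representations on $\mathbf{C}^n$, and $\mathcal{M}_{g,n}=\mathrm{Hom}(\Gamma_g,\mathrm{SU}(n))^{\mathrm{irr}}/\mathrm{PSU}(n)$ (quotient by conjugation), a smooth manifold of dimension $(2g-2)\dim\mathrm{SU}(n)$. The tangent space of $\mathcal{M}_{g,n}$ at $[\phi]$ is identified with the group cohomology $H^1(\Gamma_g,\mathrm{Ad}\,\phi)$, where $\mathrm{Ad}\,\phi$ is $\mathfrak{su}(n)$ with $\Gamma_g$ acting through $\phi$ and the adjoint action. Cup product, combined with the invariant form on $\mathfrak{su}(n)$ (the multiple of the Killing form for which the induced bi-invariant Riemannian volume on $\mathrm{SU}(n)$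 has total mass $1$) and Poincaré duality, gives a nondegenerate alternating pairing $H^1(\Gamma_g,\mathrm{Ad}\,\phi)\times H^1(\Gamma_g,\mathrm{Ad}\,\phi)\to\mathbf{R}$, hence a symplectic form $\omega_{g,n}$ on $\mathcal{M}_{g,n}$ (Atiyah–Bott–Goldman form). Let $d\mathrm{Vol}_{\mathcal{M}_{g,n}}=\wedge^{\frac12\dim\mathcal{M}_{g,n}}\omega_{g,n}/(\dim\mathcal{M}_{g,n})!$. (The normalization does not affect expected values.) For $\gamma\in\Gamma_g$ let $\mathrm{tr}_\gamma:\mathcal{M}_{g,n}\to\mathbf{C}$, $\mathrm{tr}_\gamma([\phi])=\mathrm{tr}(\phi(\gamma))$, and $$\mathbb{E}_{g,n}[\mathrm{tr}_\gamma]=\frac{\int_{\mathcal{M}_{g,n}}\mathrm{tr}_\gamma\,d\mathrm{Vol}_{\mathcal{M}_{g,n}}}{\int_{\mathcal{M}_{g,n}}d\mathrm{Vol}_{\mathcal{M}_{g,n}}}.$$ *)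

theory Defs
  imports
    "HOL-Analysis.Analysis"
    "HOL-Algebra.Generated_Groups"
    "HOL-Combinatorics.Permutations"
    "Jordan_Normal_Form.VS_Connect"
    "Jordan_Normal_Form.Schur_Decomposition"
begin

hide_const (open) Determinants.det Finite_Cartesian_Product.mat Finite_Cartesian_Product.vec

section \<open>The surface group\<close>

datatype gen = Gen_a nat | Gen_b nat

text \<open>A letter \<open>(x, e)\<close> stands for the generator \<open>x\<close> if \<open>e\<close>, and for its inverse otherwise.\<close>

type_synonym letter = "gen \<times> bool"
type_synonym word = "letter list"

definition gens :: "nat \<Rightarrow> gen set" where
  "gens g = Gen_a ` {..<g} \<union> Gen_b ` {..<g}"

definition words :: "nat \<Rightarrow> word set" where
  "words g = lists (gens g \<times> UNIV)"

definition relator :: "nat \<Rightarrow> word" where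
  "relator g = concat (map (\<lambda>i. [(Gen_a i, True), (Gen_b i, True), (Gen_a i, False), (Gen_b i, False)]) [0..<g])"

inductive surface_step :: "nat \<Rightarrow> word \<Rightarrow> word \<Rightarrow> bool" for g where
  cancel: "x \<in> gens g \<Longrightarrow> surface_step g (u @ [(x, e), (x, \<not> e)] @ v) (u @ v)"
| relator: "surface_step g (u @ relator g @ v) (u @ v)"

definition surface_rel :: "nat \<Rightarrow> (word \<times> word) set" where
  "surface_rel g = {(u, v). u \<in> words g \<and> v \<in> words g \<and> equivclp (surface_step g) u v}"

abbreviation word_class :: "nat \<Rightarrow> word \<Rightarrow> word set" where
  "word_class g u \<equiv> surface_rel g `` {u}"

definition surface_group :: "nat \<Rightarrow> word set monoid" where
  "surface_group g =
    \<lparr>carrier = words g // surface_rel g,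
     mult = (\<lambda>X Y. \<Union>u\<in>X. \<Union>v\<in>Y. word_class g (u @ v)),
     one = word_class g []\<rparr>"

abbreviation gen_class :: "nat \<Rightarrow> gen \<Rightarrow> word set" where
  "gen_class g x \<equiv> word_class g [(x, True)]"

lemma equiv_surface_rel: "equiv (words g) (surface_rel g)"
proof (rule equivI)
  show "surface_rel g \<subseteq> words g \<times> words g" by (auto simp: surface_rel_def)
  show "refl_on (words g) (surface_rel g)"
    by (auto simp: refl_on_def surface_rel_def intro: reflpD)
  show "sym (surface_rel g)"
    unfolding sym_def surface_rel_def by (blast intro: equivclp_sym)
  show "trans (surface_rel g)"
    unfolding trans_def surface_rel_def by (blast intro: equivclp_trans)
qed

lemma surface_step_append:
  assumes "surface_step g u v" shows "surface_step g (p @ u @ q) (p @ v @ q)"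
  using assms
proof cases
  case (cancel x u' e v')
  then show ?thesis using surface_step.cancel[of x g "p @ u'" e "v' @ q"] by simp
next
  case (relator u' v')
  then show ?thesis using surface_step.relator[of g "p @ u'" "v' @ q"] by simp
qed

lemma equivclp_step_append:
  assumes "equivclp (surface_step g) u v" shows "equivclp (surface_step g) (p @ u @ q) (p @ v @ q)"
  using assms
proof (induction rule: equivclp_induct)
  case base then show ?case by simp
next
  case (step y z)
  from step(2) have "equivclp (surface_step g) (p @ y @ q) (p @ z @ q)"
  proof
    assume "surface_step g y z"
    then show ?thesis by (intro r_into_equivclp surface_step_append)
  next
    assume "surface_step g z y"
    then show ?thesis by (intro equivclp_sym[OF r_into_equivclp] surface_step_append)
  qed
  with step(3) show ?case by (rule equivclp_trans)
qed

lemma relator_words: "relator g \<in> words g"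
  by (auto simp: relator_def words_def gens_def)

lemma word_class_eqI:
  assumes "equivclp (surface_step g) u v" "u \<in> words g" "v \<in> words g"
  shows "word_class g u = word_class g v"
  using assms by (intro equiv_class_eq[OF equiv_surface_rel]) (auto simp: surface_rel_def)

lemma word_class_in_carrier: "u \<in> words g \<Longrightarrow> word_class g u \<in> carrier (surface_group g)"
  by (simp add: surface_group_def quotientI)

lemma word_class_mult:
  assumes "u \<in> words g" "v \<in> words g"
  shows "word_class g u \<otimes>\<^bsub>surface_group g\<^esub> word_class g v = word_class g (u @ v)"
proof -
  have "word_class g (u' @ v') = word_class g (u @ v)"
    if "u' \<in> word_class g u" "v' \<in> word_class g v" for u' v'
  proof (rule word_class_eqI)
    have 1: "equivclp (surface_step g) u u'" "equivclp (surface_step g) v v'"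
      "u' \<in> words g" "v' \<in> words g"
      using that by (auto simp: surface_rel_def)
    then show "u' @ v' \<in> words g" "u @ v \<in> words g" using assms by (auto simp: words_def)
    have "equivclp (surface_step g) (u @ v) (u' @ v')"
      using equivclp_step_append[OF 1(1), of "[]" v] equivclp_step_append[OF 1(2), of u' "[]"]
      by simp (rule equivclp_trans)
    then show "equivclp (surface_step g) (u' @ v') (u @ v)" by (rule equivclp_sym)
  qed
  then have "(\<Union>u'\<in>word_class g u. \<Union>v'\<in>word_class g v. word_class g (u' @ v')) =
    (\<Union>u'\<in>word_class g u. \<Union>v'\<in>word_class g v. word_class g (u @ v))"
    by (intro SUP_cong refl)
  also have "\<dots> = word_class g (u @ v)"
    using equiv_class_self[OF equiv_surface_rel assms(1)]
      equiv_class_self[OF equiv_surface_rel assms(2)] by blast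
  finally show ?thesis by (simp add: surface_group_def)
qed

definition word_inv :: "word \<Rightarrow> word" where
  "word_inv w = rev (map (\<lambda>(x, e). (x, \<not> e)) w)"

lemma word_inv_cancel:
  "w \<in> words g \<Longrightarrow> equivclp (surface_step g) (word_inv w @ w) []"
proof (induction w)
  case Nil then show ?case by (simp add: word_inv_def)
next
  case (Cons l w)
  obtain x e where l: "l = (x, e)" by force
  have "surface_step g (word_inv w @ [(x, \<not> e), (x, \<not> \<not> e)] @ w) (word_inv w @ w)"
    using Cons.prems by (intro surface_step.cancel) (auto simp: l words_def)
  then have "equivclp (surface_step g) (word_inv (l # w) @ l # w) (word_inv w @ w)"
    by (intro r_into_equivclp) (simp add: word_inv_def l)
  moreover have "equivclp (surface_step g) (word_inv w @ w) []"
    using Cons by (simp add: words_def)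
  ultimately show ?case by (rule equivclp_trans)
qed

lemma group_surface_group: "group (surface_group g)"
proof (rule groupI)
  let ?G = "surface_group g"
  have rep: "\<exists>u\<in>words g. X = word_class g u" if "X \<in> carrier ?G" for X
    using that unfolding surface_group_def quotient_def by auto
  have app: "u @ v \<in> words g" if "u \<in> words g" "v \<in> words g" for u v
    using that by (auto simp: words_def)
  have nil: "[] \<in> words g" by (simp add: words_def)
  have one: "\<one>\<^bsub>?G\<^esub> = word_class g []" by (simp add: surface_group_def)
  show "X \<otimes>\<^bsub>?G\<^esub> Y \<in> carrier ?G" if "X \<in> carrier ?G" "Y \<in> carrier ?G" for X Y
    using rep[OF that(1)] rep[OF that(2)] by (auto simp: word_class_mult app word_class_in_carrier)
  show "\<one>\<^bsub>?G\<^esub> \<in> carrier ?G" using nil by (simp add: one word_class_in_carrier)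
  show "X \<otimes>\<^bsub>?G\<^esub> Y \<otimes>\<^bsub>?G\<^esub> Z = X \<otimes>\<^bsub>?G\<^esub> (Y \<otimes>\<^bsub>?G\<^esub> Z)"
    if "X \<in> carrier ?G" "Y \<in> carrier ?G" "Z \<in> carrier ?G" for X Y Z
    using rep[OF that(1)] rep[OF that(2)] rep[OF that(3)]
    by (auto simp: word_class_mult app)
  show "\<one>\<^bsub>?G\<^esub> \<otimes>\<^bsub>?G\<^esub> X = X" if "X \<in> carrier ?G" for X
    using rep[OF that] nil by (auto simp: one word_class_mult)
  show "\<exists>Y\<in>carrier ?G. Y \<otimes>\<^bsub>?G\<^esub> X = \<one>\<^bsub>?G\<^esub>" if X: "X \<in> carrier ?G" for X
  proof -
    obtain u where u: "u \<in> words g" "X = word_class g u" using rep[OF X] by auto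
    then have i: "word_inv u \<in> words g" by (auto simp: words_def word_inv_def)
    have "word_class g (word_inv u) \<otimes>\<^bsub>?G\<^esub> X = \<one>\<^bsub>?G\<^esub>"
      using u i nil word_inv_cancel[OF u(1)] by (simp add: word_class_mult one app word_class_eqI)
    with i show ?thesis by (auto intro: word_class_in_carrier)
  qed
qed

section \<open>The group SU(n) and its Lie algebra\<close>

definition SU :: "nat \<Rightarrow> complex mat monoid" where
  "SU n =
    \<lparr>carrier = {A \<in> carrier_mat n n. A * mat_adjoint A = 1\<^sub>m n \<and> det A = 1},
     mult = (*), one = 1\<^sub>m n\<rparr>"

definition mat_trace :: "complex mat \<Rightarrow> complex" where
  "mat_trace A = (\<Sum>i<dim_row A. A $$ (i, i))"

definition su :: "nat \<Rightarrow> complex mat set" where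
  "su n = {X \<in> carrier_mat n n. mat_adjoint X = - X \<and> mat_trace X = 0}"

definition Ad :: "nat \<Rightarrow> complex mat \<Rightarrow> complex mat \<Rightarrow> complex mat" where
  "Ad n A X = A * X * inv\<^bsub>SU n\<^esub> A"

definition ad :: "complex mat \<Rightarrow> complex mat \<Rightarrow> complex mat" where
  "ad X Y = X * Y - Y * X"

text \<open>Real linear combinations of complex \<open>n \<times> n\<close> matrices.\<close>

definition real_lincomb :: "nat \<Rightarrow> nat \<Rightarrow> (nat \<Rightarrow> real) \<Rightarrow> (nat \<Rightarrow> complex mat) \<Rightarrow> complex mat" where
  "real_lincomb n m c e = mat n n (\<lambda>(i, j). \<Sum>k<m. complex_of_real (c k) * e k $$ (i, j))"

definition su_dim :: "nat \<Rightarrow> nat" where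
  "su_dim n = n\<^sup>2 - 1"

definition su_basis :: "nat \<Rightarrow> (nat \<Rightarrow> complex mat) \<Rightarrow> bool" where
  "su_basis n e \<longleftrightarrow>
    (\<forall>i<su_dim n. e i \<in> su n) \<and>
    (\<forall>X\<in>su n. \<exists>!c. c \<in> {..<su_dim n} \<rightarrow>\<^sub>E UNIV \<and> X = real_lincomb n (su_dim n) c e)"

text \<open>The Killing form: the trace of \<open>ad X \<circ> ad Y\<close> as an endomorphism of the real vector space
  \<open>su n\<close>, computed from its matrix \<open>M\<close> in a basis.\<close>

definition killing :: "nat \<Rightarrow> complex mat \<Rightarrow> complex mat \<Rightarrow> real" where
  "killing n X Y =
    (THE t. \<exists>e M. su_basis n e \<and>
      (\<forall>j<su_dim n. ad X (ad Y (e j)) = real_lincomb n (su_dim n) (\<lambda>i. M i j) e) \<and>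
      t = (\<Sum>i<su_dim n. M i i))"

lemma mat_adjoint_index:
  "i < dim_col A \<Longrightarrow> j < dim_row A \<Longrightarrow> mat_adjoint A $$ (i, j) = conjugate (A $$ (j, i))"
  by (simp add: mat_adjoint_def mat_of_rows_def)

lemma mat_adjoint_dim: "dim_row (mat_adjoint A) = dim_col A" "dim_col (mat_adjoint A) = dim_row A"
  by (auto simp: mat_adjoint_def mat_of_rows_def)

lemma mat_adjoint_mult:
  fixes A B :: "complex mat"
  assumes "A \<in> carrier_mat n n" "B \<in> carrier_mat n n"
  shows "mat_adjoint (A * B) = mat_adjoint B * mat_adjoint A"
proof (rule eq_matI)
  fix i j assume "i < dim_row (mat_adjoint B * mat_adjoint A)" "j < dim_col (mat_adjoint B * mat_adjoint A)"
  then have ij: "i < n" "j < n" using assms by (auto simp: mat_adjoint_dim)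
  have "mat_adjoint (A * B) $$ (i, j) = cnj (\<Sum>k\<in>{0..<n}. A $$ (j, k) * B $$ (k, i))"
    using ij assms by (simp add: mat_adjoint_index scalar_prod_def conjugate_complex_def)
  also have "\<dots> = (\<Sum>k\<in>{0..<n}. cnj (B $$ (k, i)) * cnj (A $$ (j, k)))"
    by (simp add: cnj_sum mult.commute)
  also have "\<dots> = (mat_adjoint B * mat_adjoint A) $$ (i, j)"
    using ij assms
    by (simp add: mat_adjoint_index mat_adjoint_dim scalar_prod_def conjugate_complex_def)
  finally show "mat_adjoint (A * B) $$ (i, j) = (mat_adjoint B * mat_adjoint A) $$ (i, j)" .
qed (use assms in \<open>auto simp: mat_adjoint_dim\<close>)

lemma mat_adjoint_adjoint: "mat_adjoint (mat_adjoint A) = A"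
  by (intro eq_matI) (auto simp: mat_adjoint_index mat_adjoint_dim)

lemma mat_adjoint_one: "mat_adjoint (1\<^sub>m n :: complex mat) = 1\<^sub>m n"
  by (intro eq_matI) (auto simp: mat_adjoint_index mat_adjoint_dim)

lemma mat_adjoint_carrier: "A \<in> carrier_mat n m \<Longrightarrow> mat_adjoint A \<in> carrier_mat m n"
  by (rule carrier_matI) (auto simp: mat_adjoint_dim)

lemma group_SU: "group (SU n)"
proof (rule groupI)
  have S: "A \<in> carrier (SU n) \<longleftrightarrow> A \<in> carrier_mat n n \<and> A * mat_adjoint A = 1\<^sub>m n \<and> det A = 1" for A
    by (simp add: SU_def)
  have M: "A \<otimes>\<^bsub>SU n\<^esub> B = A * B" "\<one>\<^bsub>SU n\<^esub> = 1\<^sub>m n" for A B by (auto simp: SU_def)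
  have L: "mat_adjoint A * A = 1\<^sub>m n" if "A \<in> carrier (SU n)" for A
    using that mat_mult_left_right_inverse[of A n "mat_adjoint A"]
    by (auto simp: S mat_adjoint_carrier)
  show "A \<otimes>\<^bsub>SU n\<^esub> B \<in> carrier (SU n)" if "A \<in> carrier (SU n)" "B \<in> carrier (SU n)" for A B
  proof -
    have c: "A \<in> carrier_mat n n" "B \<in> carrier_mat n n" "mat_adjoint A \<in> carrier_mat n n"
      "mat_adjoint B \<in> carrier_mat n n"
      using that by (auto simp: S mat_adjoint_carrier)
    have "A * B * (mat_adjoint B * mat_adjoint A) = A * (B * mat_adjoint B) * mat_adjoint A"
      using c by (simp add: assoc_mult_mat[of _ n n _ n _ n])
    also have "\<dots> = 1\<^sub>m n" using that c by (simp add: S)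
    finally show ?thesis using that c by (simp add: S M mat_adjoint_mult det_mult[of A n B])
  qed
  show "\<one>\<^bsub>SU n\<^esub> \<in> carrier (SU n)" by (simp add: S M mat_adjoint_one)
  show "A \<otimes>\<^bsub>SU n\<^esub> B \<otimes>\<^bsub>SU n\<^esub> C = A \<otimes>\<^bsub>SU n\<^esub> (B \<otimes>\<^bsub>SU n\<^esub> C)"
    if "A \<in> carrier (SU n)" "B \<in> carrier (SU n)" "C \<in> carrier (SU n)" for A B C
    using that by (simp add: S M assoc_mult_mat[of _ n n _ n _ n])
  show "\<one>\<^bsub>SU n\<^esub> \<otimes>\<^bsub>SU n\<^esub> A = A" if "A \<in> carrier (SU n)" for A
    using that by (simp add: S M left_mult_one_mat[of A n n])
  show "\<exists>B\<in>carrier (SU n). B \<otimes>\<^bsub>SU n\<^esub> A = \<one>\<^bsub>SU n\<^esub>" if "A \<in> carrier (SU n)" for A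
  proof (rule bexI)
    show "mat_adjoint A \<otimes>\<^bsub>SU n\<^esub> A = \<one>\<^bsub>SU n\<^esub>" using L[OF that] by (simp add: M)
    have c: "A \<in> carrier_mat n n" "mat_adjoint A \<in> carrier_mat n n"
      using that by (auto simp: S mat_adjoint_carrier)
    have "det (mat_adjoint A * A) = det (mat_adjoint A)"
      using that c by (simp add: det_mult[of _ n] S)
    then have "det (mat_adjoint A) = 1" using L[OF that] by simp
    then show "mat_adjoint A \<in> carrier (SU n)"
      using c L[OF that] by (simp add: S mat_adjoint_adjoint)
  qed
qed

section \<open>Calculus and measures in local parametrizations\<close>

text \<open>\<open>R\<^sup>d\<close> is the set of extensional functions on \<open>{..<d}\<close>.\<close>

definition euclid :: "nat \<Rightarrow> (nat \<Rightarrow> real) topology" where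
  "euclid d = product_topology (\<lambda>_. euclidean) {..<d}"

definition partial_deriv :: "nat \<Rightarrow> ((nat \<Rightarrow> real) \<Rightarrow> complex) \<Rightarrow> (nat \<Rightarrow> real) \<Rightarrow> complex" where
  "partial_deriv i f x = vector_derivative (\<lambda>t. f (x(i := t))) (at (x i))"

primrec C_k_on :: "nat \<Rightarrow> nat \<Rightarrow> (nat \<Rightarrow> real) set \<Rightarrow> ((nat \<Rightarrow> real) \<Rightarrow> complex) \<Rightarrow> bool" where
  "C_k_on 0 d U f \<longleftrightarrow> continuous_map (subtopology (euclid d) U) euclidean f"
| "C_k_on (Suc k) d U f \<longleftrightarrow>
    continuous_map (subtopology (euclid d) U) euclidean f \<and>
    (\<forall>i<d. (\<forall>x\<in>U. (\<lambda>t. f (x(i := t))) differentiable at (x i)) \<and> C_k_on k d U (partial_deriv i f))"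

definition smooth_mat_on ::
    "nat \<Rightarrow> nat \<Rightarrow> (nat \<Rightarrow> real) set \<Rightarrow> ((nat \<Rightarrow> real) \<Rightarrow> complex mat) \<Rightarrow> bool" where
  "smooth_mat_on d n U F \<longleftrightarrow> (\<forall>i<n. \<forall>j<n. \<forall>k. C_k_on k d U (\<lambda>x. F x $$ (i, j)))"

definition mat_partial_deriv ::
    "nat \<Rightarrow> nat \<Rightarrow> ((nat \<Rightarrow> real) \<Rightarrow> complex mat) \<Rightarrow> (nat \<Rightarrow> real) \<Rightarrow> complex mat" where
  "mat_partial_deriv n i F x = mat n n (\<lambda>(r, s). partial_deriv i (\<lambda>y. F y $$ (r, s)) x)"

text \<open>The Borel measure on a \<open>d\<close>-dimensional manifold that is given by a density. The set \<open>P\<close> consists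
  of the triples \<open>(U, f, \<rho>)\<close> of an open \<open>U \<subseteq> R\<^sup>d\<close>, a diffeomorphism \<open>f\<close> from \<open>U\<close> onto an open subset,
  and the expression \<open>\<rho>\<close> of the density in the coordinates \<open>f\<close>. Each triple determines the measure
  on \<open>f ` U\<close> (extended by zero) as the push-forward of \<open>\<rho>\<close> times Lebesgue measure; as the measures for
  two triples agree on the intersection of the images, their least upper bound in the complete
  lattice of measures is the measure obtained by glueing.\<close>

definition density_measure ::
    "nat \<Rightarrow> 'p topology \<Rightarrow>
      ((nat \<Rightarrow> real) set \<times> ((nat \<Rightarrow> real) \<Rightarrow> 'p) \<times> ((nat \<Rightarrow> real) \<Rightarrow> real)) set \<Rightarrow> 'p measure" where
  "density_measure d T P =
    (SUP (U, f, \<rho>)\<in>P.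
      distr (density (restrict_space (Pi\<^sub>M {..<d} (\<lambda>_. lborel)) U) (\<lambda>x. ennreal (\<rho> x)))
        (sigma (topspace T) {V. openin T V}) f)"

section \<open>The invariant form\<close>

definition SU_topology :: "nat \<Rightarrow> complex mat topology" where
  "SU_topology n =
    pullback_topology (carrier (SU n)) (\<lambda>A. restrict (($$) A) ({..<n} \<times> {..<n}))
      (product_topology (\<lambda>_. euclidean) ({..<n} \<times> {..<n}))"

text \<open>Tangent vectors of \<open>SU n\<close> are moved to the Lie algebra by right translation.\<close>

definition SU_tangent :: "nat \<Rightarrow> ((nat \<Rightarrow> real) \<Rightarrow> complex mat) \<Rightarrow> (nat \<Rightarrow> real) \<Rightarrow> nat \<Rightarrow> complex mat" where
  "SU_tangent n f x i = mat_partial_deriv n i f x * inv\<^bsub>SU n\<^esub> (f x)"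

definition SU_parametrization ::
    "nat \<Rightarrow> (nat \<Rightarrow> real) set \<Rightarrow> ((nat \<Rightarrow> real) \<Rightarrow> complex mat) \<Rightarrow> bool" where
  "SU_parametrization n U f \<longleftrightarrow>
    openin (euclid (su_dim n)) U \<and> f \<in> U \<rightarrow> carrier (SU n) \<and> smooth_mat_on (su_dim n) n U f \<and>
    inj_on f U \<and> (\<forall>x\<in>U. su_basis n (SU_tangent n f x))"

text \<open>The Riemannian volume of the bi-invariant metric given by \<open>c\<close> times the Killing form.\<close>

definition SU_volume :: "nat \<Rightarrow> real \<Rightarrow> complex mat measure" where
  "SU_volume n c =
    density_measure (su_dim n) (SU_topology n)
      {(U, f, \<lambda>x. sqrt (det (mat (su_dim n) (su_dim n)
          (\<lambda>(i, j). c * killing n (SU_tangent n f x i) (SU_tangent n f x j))))) | U f.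
        SU_parametrization n U f}"

text \<open>The (negative) multiple of the Killing form that is positive definite and gives \<open>SU n\<close> volume 1;
  unique for \<open>n \<ge> 2\<close>, and irrelevant for \<open>n = 1\<close> where the Lie algebra is zero.\<close>

definition killing_multiple :: "nat \<Rightarrow> real" where
  "killing_multiple n =
    (THE c. (\<forall>X\<in>su n. X \<noteq> 0\<^sub>m n n \<longrightarrow> c * killing n X X > 0) \<and>
      emeasure (SU_volume n c) (carrier (SU n)) = 1)"

definition invariant_form :: "nat \<Rightarrow> complex mat \<Rightarrow> complex mat \<Rightarrow> real" where
  "invariant_form n X Y = killing_multiple n * killing n X Y"

section \<open>The moduli space\<close>

type_synonym rep = "word set \<Rightarrow> complex mat"

definition rep_space :: "nat \<Rightarrow> nat \<Rightarrow> rep set" where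
  "rep_space g n = hom (surface_group g) (SU n) \<inter> extensional (carrier (surface_group g))"

definition irreducible_rep :: "nat \<Rightarrow> nat \<Rightarrow> rep \<Rightarrow> bool" where
  "irreducible_rep g n \<phi> \<longleftrightarrow> n > 0 \<and>
    (\<forall>W. VectorSpace.subspace class_ring W (module_vec TYPE(complex) n) \<and>
        (\<forall>\<gamma>\<in>carrier (surface_group g). \<forall>w\<in>W. \<phi> \<gamma> *\<^sub>v w \<in> W)
      \<longrightarrow> W = {0\<^sub>v n} \<or> W = carrier_vec n)"

definition irr_space :: "nat \<Rightarrow> nat \<Rightarrow> rep set" where
  "irr_space g n = {\<phi> \<in> rep_space g n. irreducible_rep g n \<phi>}"

definition irr_topology :: "nat \<Rightarrow> nat \<Rightarrow> rep topology" where
  "irr_topology g n =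
    pullback_topology (irr_space g n) (\<lambda>\<phi>. \<lambda>x\<in>gens g. \<phi> (gen_class g x))
      (product_topology (\<lambda>_. SU_topology n) (gens g))"

text \<open>The centre of \<open>SU n\<close> acts trivially by conjugation, so these are the orbits under \<open>PSU n\<close>.\<close>

definition conj_orbit :: "nat \<Rightarrow> nat \<Rightarrow> rep \<Rightarrow> rep set" where
  "conj_orbit g n \<phi> =
    {\<lambda>\<gamma>\<in>carrier (surface_group g). A * \<phi> \<gamma> * inv\<^bsub>SU n\<^esub> A | A. A \<in> carrier (SU n)}"

definition moduli :: "nat \<Rightarrow> nat \<Rightarrow> rep set set" where
  "moduli g n = conj_orbit g n ` irr_space g n"

definition moduli_topology :: "nat \<Rightarrow> nat \<Rightarrow> rep set topology" where
  "moduli_topology g n =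
    topology (\<lambda>V. V \<subseteq> moduli g n \<and> openin (irr_topology g n) {\<phi> \<in> irr_space g n. conj_orbit g n \<phi> \<in> V})"

definition moduli_dim :: "nat \<Rightarrow> nat \<Rightarrow> nat" where
  "moduli_dim g n = (2 * g - 2) * su_dim n"

lemma openin_moduli_topology:
  "openin (moduli_topology g n) V \<longleftrightarrow>
    V \<subseteq> moduli g n \<and> openin (irr_topology g n) {\<phi> \<in> irr_space g n. conj_orbit g n \<phi> \<in> V}"
proof -
  have "istopology (\<lambda>V. V \<subseteq> moduli g n \<and>
    openin (irr_topology g n) {\<phi> \<in> irr_space g n. conj_orbit g n \<phi> \<in> V})" (is "istopology ?P")
    unfolding istopology_def
  proof (intro conjI allI impI)
    fix S T assume *: "?P S" "?P T"
    then show "S \<inter> T \<subseteq> moduli g n" by auto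
    have "{\<phi> \<in> irr_space g n. conj_orbit g n \<phi> \<in> S \<inter> T} =
      {\<phi> \<in> irr_space g n. conj_orbit g n \<phi> \<in> S} \<inter> {\<phi> \<in> irr_space g n. conj_orbit g n \<phi> \<in> T}" by auto
    then show "openin (irr_topology g n) {\<phi> \<in> irr_space g n. conj_orbit g n \<phi> \<in> S \<inter> T}"
      using * by (simp add: openin_Int)
  next
    fix K assume *: "\<forall>S\<in>K. ?P S"
    then show "\<Union>K \<subseteq> moduli g n" by auto
    have "{\<phi> \<in> irr_space g n. conj_orbit g n \<phi> \<in> \<Union>K} =
      (\<Union>S\<in>K. {\<phi> \<in> irr_space g n. conj_orbit g n \<phi> \<in> S})" by auto
    then show "openin (irr_topology g n) {\<phi> \<in> irr_space g n. conj_orbit g n \<phi> \<in> \<Union>K}"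
      using * by (auto intro!: openin_Union)
  qed
  then show ?thesis unfolding moduli_topology_def by (simp add: topology_inverse')
qed

section \<open>Group cohomology with coefficients in the adjoint representation\<close>

definition cocycles :: "nat \<Rightarrow> nat \<Rightarrow> rep \<Rightarrow> rep set" where
  "cocycles g n \<phi> =
    {u \<in> carrier (surface_group g) \<rightarrow>\<^sub>E su n.
      \<forall>x\<in>carrier (surface_group g). \<forall>y\<in>carrier (surface_group g).
        u (x \<otimes>\<^bsub>surface_group g\<^esub> y) = u x + Ad n (\<phi> x) (u y)}"

definition coboundary :: "nat \<Rightarrow> nat \<Rightarrow> rep \<Rightarrow> complex mat \<Rightarrow> rep" where
  "coboundary g n \<phi> X = (\<lambda>x\<in>carrier (surface_group g). Ad n (\<phi> x) X - X)"

definition cohom_class :: "nat \<Rightarrow> nat \<Rightarrow> rep \<Rightarrow> rep \<Rightarrow> rep set" where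
  "cohom_class g n \<phi> u =
    {\<lambda>x\<in>carrier (surface_group g). u x + coboundary g n \<phi> X x | X. X \<in> su n}"

definition H1 :: "nat \<Rightarrow> nat \<Rightarrow> rep \<Rightarrow> rep set set" where
  "H1 g n \<phi> = cohom_class g n \<phi> ` cocycles g n \<phi>"

definition cup_product :: "nat \<Rightarrow> rep \<Rightarrow> rep \<Rightarrow> rep \<Rightarrow> word set \<Rightarrow> word set \<Rightarrow> real" where
  "cup_product n \<phi> u v x y = invariant_form n (u x) (Ad n (\<phi> x) (v y))"

text \<open>Poincare duality identifies \<open>H\<^sup>2(\<Gamma>, R)\<close> with \<open>R\<close> by evaluation on the fundamental class. In the bar
  complex the latter is represented by the sum over \<open>x\<close> of \<open>[\<partial>R/\<partial>x | x]\<close>, where \<open>R\<close> is the relator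
  and \<open>\<partial>R/\<partial>x\<close> is the Fox derivative (Goldman): an occurrence of a generator \<open>x\<close> in \<open>R = p x q\<close> contributes
  \<open>[p | x]\<close>, an occurrence of its inverse in \<open>R = p x\<^sup>-\<^sup>1 q\<close> contributes \<open>- [p x\<^sup>-\<^sup>1 | x]\<close>.\<close>

definition fundamental_eval :: "nat \<Rightarrow> (word set \<Rightarrow> word set \<Rightarrow> real) \<Rightarrow> real" where
  "fundamental_eval g c =
    (\<Sum>k<length (relator g). case relator g ! k of (x, e) \<Rightarrow>
      if e then c (word_class g (take k (relator g))) (gen_class g x)
      else - c (word_class g (take (Suc k) (relator g))) (gen_class g x))"

text \<open>The evaluation vanishes on coboundaries: the chain above is a cycle.\<close>

lemma fundamental_eval_coboundary:
  fixes f :: "word set \<Rightarrow> real"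
  shows "fundamental_eval g (\<lambda>x y. f y - f (x \<otimes>\<^bsub>surface_group g\<^esub> y) + f x) = 0"
proof -
  let ?R = "relator g" and ?c = "\<lambda>x y. f y - f (x \<otimes>\<^bsub>surface_group g\<^esub> y) + f x"
  let ?p = "\<lambda>k. f (word_class g (take k ?R))"
  let ?s = "\<lambda>l. if snd l then f (gen_class g (fst l)) else - f (gen_class g (fst l))"
  have "(case ?R ! k of (x, e) \<Rightarrow>
      if e then ?c (word_class g (take k ?R)) (gen_class g x)
      else - ?c (word_class g (take (Suc k) ?R)) (gen_class g x)) = ?s (?R ! k) + (?p k - ?p (Suc k))"
    if k: "k < length ?R" for k
  proof -
    obtain x e where xe: "?R ! k = (x, e)" by force
    have "(x, e) \<in> set ?R" using k xe nth_mem by metis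
    then have x: "x \<in> gens g" using relator_words by (auto simp: words_def)
    have w: "take m ?R \<in> words g" for m
      using relator_words[of g] by (auto simp: words_def dest: in_set_takeD)
    have x1: "[(x, True)] \<in> words g" using x by (simp add: words_def)
    have tk: "take (Suc k) ?R = take k ?R @ [(x, e)]" using k xe by (simp add: take_Suc_conv_app_nth)
    show ?thesis
    proof (cases e)
      case True
      then show ?thesis using word_class_mult[OF w[of k] x1] by (simp add: xe tk)
    next
      case False
      have "word_class g (take (Suc k) ?R @ [(x, True)]) = word_class g (take k ?R)"
      proof (rule word_class_eqI)
        show "take (Suc k) ?R @ [(x, True)] \<in> words g" using w[of "Suc k"] x1 by (simp add: words_def)
        show "equivclp (surface_step g) (take (Suc k) ?R @ [(x, True)]) (take k ?R)"
          using surface_step.cancel[OF x, of "take k ?R" False "[]"] False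
          by (intro r_into_equivclp) (simp add: tk)
      qed (rule w)
      with False show ?thesis using word_class_mult[OF w[of "Suc k"] x1] by (simp add: xe)
    qed
  qed
  note summand = this
  have "sum_list (map ?s (concat (map (\<lambda>i. [(Gen_a i, True), (Gen_b i, True), (Gen_a i, False),
    (Gen_b i, False)]) xs))) = 0" for xs
    by (induction xs) auto
  then have zero: "sum_list (map ?s ?R) = 0" unfolding relator_def .
  have "fundamental_eval g ?c = (\<Sum>k<length ?R. ?s (?R ! k) + (?p k - ?p (Suc k)))"
    unfolding fundamental_eval_def using summand by (intro sum.cong) auto
  also have "\<dots> = (\<Sum>k<length ?R. ?s (?R ! k)) + (?p 0 - ?p (length ?R))"
    by (subst sum.distrib, subst sum_lessThan_telescope') simp
  also have "(\<Sum>k<length ?R. ?s (?R ! k)) = sum_list (map ?s ?R)"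
    by (simp add: sum_list_sum_nth atLeast0LessThan)
  also have "\<dots> = 0" by (rule zero)
  also have "word_class g (take (length ?R) ?R) = word_class g []"
    using surface_step.relator[of g "[]" "[]"] relator_words
    by (intro word_class_eqI r_into_equivclp) (auto simp: words_def)
  finally show ?thesis by simp
qed

text \<open>The Atiyah--Bott--Goldman form on \<open>H\<^sup>1(\<Gamma>, Ad \<phi>)\<close>, the tangent space at the class of \<open>\<phi>\<close>; the
  value does not depend on the representatives.\<close>

definition ABG_form :: "nat \<Rightarrow> nat \<Rightarrow> rep \<Rightarrow> rep set \<Rightarrow> rep set \<Rightarrow> real" where
  "ABG_form g n \<phi> a b = (THE r. \<exists>u\<in>a. \<exists>v\<in>b. r = fundamental_eval g (cup_product n \<phi> u v))"

section \<open>The symplectic volume and expected values\<close>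

text \<open>A parametrization of an open subset of the moduli space is given by a lift \<open>f\<close> to the
  irreducible representations. Such parametrizations cover the moduli space, since the projection
  from the irreducible representations is a principal bundle. The \<open>i\<close>-th coordinate vector field
  is the class of the cocycle \<open>\<gamma> \<mapsto> \<partial>\<^sub>i f(\<gamma>) f(\<gamma>)\<^sup>-\<^sup>1\<close>; by the inverse function theorem,
  the map to the moduli space is a diffeomorphism onto an open subset iff it is injective
  and the coordinate vectors form a basis of \<open>H\<^sup>1\<close> everywhere.\<close>

definition tangent_cocycle :: "nat \<Rightarrow> nat \<Rightarrow> ((nat \<Rightarrow> real) \<Rightarrow> rep) \<Rightarrow> (nat \<Rightarrow> real) \<Rightarrow> nat \<Rightarrow> rep" where
  "tangent_cocycle g n f x i =
    (\<lambda>\<gamma>\<in>carrier (surface_group g). mat_partial_deriv n i (\<lambda>y. f y \<gamma>) x * inv\<^bsub>SU n\<^esub> (f x \<gamma>))"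

definition H1_basis :: "nat \<Rightarrow> nat \<Rightarrow> rep \<Rightarrow> (nat \<Rightarrow> rep) \<Rightarrow> bool" where
  "H1_basis g n \<phi> u \<longleftrightarrow>
    (\<forall>i<moduli_dim g n. u i \<in> cocycles g n \<phi>) \<and>
    (\<forall>a\<in>H1 g n \<phi>. \<exists>!c. c \<in> {..<moduli_dim g n} \<rightarrow>\<^sub>E UNIV \<and>
      a = cohom_class g n \<phi>
        (\<lambda>\<gamma>\<in>carrier (surface_group g). real_lincomb n (moduli_dim g n) c (\<lambda>i. u i \<gamma>)))"

definition moduli_parametrization ::
    "nat \<Rightarrow> nat \<Rightarrow> (nat \<Rightarrow> real) set \<Rightarrow> ((nat \<Rightarrow> real) \<Rightarrow> rep) \<Rightarrow> bool" where
  "moduli_parametrization g n U f \<longleftrightarrow>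
    openin (euclid (moduli_dim g n)) U \<and> f \<in> U \<rightarrow> irr_space g n \<and>
    (\<forall>x\<in>gens g. smooth_mat_on (moduli_dim g n) n U (\<lambda>y. f y (gen_class g x))) \<and>
    inj_on (\<lambda>y. conj_orbit g n (f y)) U \<and>
    (\<forall>y\<in>U. H1_basis g n (f y) (tangent_cocycle g n f y))"

text \<open>The value of the \<open>k\<close>-th exterior power of the 2-form \<open>\<omega>\<close> on \<open>(v 0, \<dots>, v (2 k - 1))\<close>.\<close>

definition wedge_power :: "nat \<Rightarrow> ('v \<Rightarrow> 'v \<Rightarrow> real) \<Rightarrow> (nat \<Rightarrow> 'v) \<Rightarrow> real" where
  "wedge_power k \<omega> v =
    (\<Sum>p | p permutes {..<2 * k}.
      of_int (sign p) * (\<Prod>i<k. \<omega> (v (p (2 * i))) (v (p (2 * i + 1))))) / 2 ^ k"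

text \<open>The absolute value expresses that the moduli space is oriented by its volume form.\<close>

definition moduli_volume :: "nat \<Rightarrow> nat \<Rightarrow> rep set measure" where
  "moduli_volume g n =
    density_measure (moduli_dim g n) (moduli_topology g n)
      {(U, \<lambda>x. conj_orbit g n (f x),
        \<lambda>x. \<bar>wedge_power (moduli_dim g n div 2) (ABG_form g n (f x))
            (\<lambda>i. cohom_class g n (f x) (tangent_cocycle g n f x i))\<bar> / fact (moduli_dim g n)) | U f.
        moduli_parametrization g n U f}"

definition moduli_trace :: "word set \<Rightarrow> rep set \<Rightarrow> complex" where
  "moduli_trace \<gamma> p = (THE z. \<exists>\<phi>\<in>p. z = mat_trace (\<phi> \<gamma>))"

definition expected_value :: "nat \<Rightarrow> nat \<Rightarrow> (rep set \<Rightarrow> complex) \<Rightarrow> complex" where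
  "expected_value g n h = (\<integral>p. h p \<partial>moduli_volume g n) / (\<integral>p. 1 \<partial>moduli_volume g n)"

end

theory Submission
  imports Defs
begin

text \<open>The centre of \<open>SU n\<close> consists of the scalar matrices \<open>z\<close> with \<open>z\<^sup>n = 1\<close>. Hence a character
  \<open>\<xi>\<close> of the surface group \<open>\<Gamma>\<close> with values in the \<open>n\<close>-th roots of unity acts on
  representations by \<open>\<phi> \<mapsto> \<xi> \<phi>\<close>. This twist commutes with conjugation and keeps
  irreducibility, so it acts on the moduli space. It preserves the symplectic volume: scalars act
  trivially in the adjoint representation, so \<open>\<phi>\<close> and \<open>\<xi> \<phi>\<close> have the same cocycles, the same
  first cohomology and the same Atiyah--Bott--Goldman form, and a path of representations has the
  same tangent cocycle before and after twisting. On the other hand the twist multiplies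
  \<open>tr\<^sub>\<gamma>\<close> by the constant \<open>\<xi> \<gamma>\<close>. Invariance of the volume gives
  \<open>\<integral> tr\<^sub>\<gamma> = \<xi> \<gamma> \<integral> tr\<^sub>\<gamma>\<close>, so the integral vanishes as soon as some character has \<open>\<xi> \<gamma> \<noteq> 1\<close>
  (\<open>expected_value_moduli_trace_eq_0\<close>).

  Such characters come from exponent sums. The relator has exponent sum zero in each generator
  \<open>x\<close>, so the exponent sum of \<open>x\<close> is a homomorphism from \<open>\<Gamma>\<close> to the integers, and an element all of
  whose exponent sums vanish lies in the commutator subgroup
  (\<open>exponent_sums_zero_imp_derived\<close>). If \<open>\<gamma>\<close> is not in the commutator subgroup, some exponent
  sum \<open>m\<close> of \<open>\<gamma>\<close> is nonzero. Then \<open>\<delta> \<mapsto> exp (2 \<pi> i e(\<delta>) / n)\<close>, where \<open>e\<close> is that exponent sum,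
  takes the value \<open>exp (2 \<pi> i m / n) \<noteq> 1\<close> at \<open>\<gamma>\<close> for all \<open>n > \<bar>m\<bar>\<close>.

  The volume is the least upper bound of the measures given by the local parametrizations of the
  moduli space. Its invariance follows from two facts: twisting permutes the parametrizations and
  respects their densities (\<open>chart_measure_eq_distr\<close>), and the least upper bound of a family of
  measures that a measurable bijection permutes is invariant (\<open>distr_SUP_eq_SUP\<close>).\<close>

section \<open>Exponent sums and the commutator subgroup\<close>

lemma gen_class_carrier: "x \<in> gens g \<Longrightarrow> gen_class g x \<in> carrier (surface_group g)"
  by (intro word_class_in_carrier) (simp add: words_def)

lemma word_class_inverse_letter:
  assumes x: "x \<in> gens g"
  shows "word_class g [(x, False)] = inv\<^bsub>surface_group g\<^esub> gen_class g x"
proof -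
  let ?G = "surface_group g"
  interpret group ?G by (rule group_surface_group)
  have c: "word_class g [(x, b)] \<in> carrier ?G" for b
    using x by (intro word_class_in_carrier) (simp add: words_def)
  have "word_class g [(x, False)] \<otimes>\<^bsub>?G\<^esub> gen_class g x = word_class g [(x, False), (x, True)]"
    using x by (subst word_class_mult) (auto simp: words_def)
  also have "\<dots> = word_class g []"
    using surface_step.cancel[OF x, of "[]" False "[]"] x
    by (intro word_class_eqI r_into_equivclp) (auto simp: words_def)
  finally have "word_class g [(x, False)] \<otimes>\<^bsub>?G\<^esub> gen_class g x = \<one>\<^bsub>?G\<^esub>"
    by (simp add: surface_group_def)
  then show ?thesis using c by (simp add: inv_equality)
qed

definition exponent_sum :: "gen \<Rightarrow> word \<Rightarrow> int" where
  "exponent_sum x w = (\<Sum>(y, e)\<leftarrow>w. if y = x then if e then 1 else -1 else 0)"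

lemma exponent_sum_simps [simp]:
  "exponent_sum x [] = 0"
  "exponent_sum x ((y, e) # w) = (if y = x then if e then 1 else -1 else 0) + exponent_sum x w"
  "exponent_sum x (u @ v) = exponent_sum x u + exponent_sum x v"
  by (simp_all add: exponent_sum_def)

lemma exponent_sum_relator [simp]: "exponent_sum x (relator g) = 0"
proof -
  have "exponent_sum x (concat (map (\<lambda>i. [(Gen_a i, True), (Gen_b i, True), (Gen_a i, False),
    (Gen_b i, False)]) is)) = 0" for "is"
    by (induction "is") auto
  then show ?thesis unfolding relator_def .
qed

lemma exponent_sum_equivclp:
  assumes "equivclp (surface_step g) u v"
  shows "exponent_sum x u = exponent_sum x v"
  using assms
proof (induction rule: equivclp_induct)
  case (step y z)
  moreover have "exponent_sum x a = exponent_sum x b" if "surface_step g a b" for a b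
    using that by cases auto
  ultimately show ?case by metis
qed simp

text \<open>In an abelian group the letters of a word can be collected generator by generator, so a
  homomorphism to it sees only the exponent sums.\<close>

lemma hom_word_class_eq_finprod:
  assumes Q: "comm_group Q" and h: "h \<in> hom (surface_group g) Q" and w: "w \<in> words g"
  shows "h (word_class g w) = (\<Otimes>\<^bsub>Q\<^esub>x\<in>gens g. h (gen_class g x) [^]\<^bsub>Q\<^esub> exponent_sum x w)"
proof -
  let ?G = "surface_group g"
  interpret G: group ?G by (rule group_surface_group)
  interpret Q: comm_group Q by (rule Q)
  interpret h: group_hom ?G Q h by unfold_locales (rule h)
  have fin: "finite (gens g)" by (simp add: gens_def)
  have gen: "h (gen_class g x) \<in> carrier Q" if "x \<in> gens g" for x
    by (rule h.hom_closed[OF gen_class_carrier[OF that]])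
  have letter: "h (word_class g [(y, e)]) = h (gen_class g y) [^]\<^bsub>Q\<^esub> (if e then 1 else -1 :: int)"
    if y: "y \<in> gens g" for y e
    using gen[OF y] gen_class_carrier[OF y] word_class_inverse_letter[OF y]
    by (cases e) (simp_all add: Q.int_pow_neg)
  \<comment> \<open>A letter contributes the product all of whose factors but one are trivial; in the
    commutative group \<open>Q\<close>, products over the generators multiply factor by factor.\<close>
  from w show ?thesis
  proof (induction w)
    case Nil
    have "h (word_class g []) = \<one>\<^bsub>Q\<^esub>" using h.hom_one by (simp add: surface_group_def)
    then show ?case by simp
  next
    case (Cons l w)
    obtain y e where l: "l = (y, e)" by force
    let ?p = "\<lambda>x i. h (gen_class g x) [^]\<^bsub>Q\<^esub> (i :: int)"
    let ?s = "if e then 1 else -1 :: int"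
    let ?a = "\<lambda>x. if y = x then ?p x ?s else \<one>\<^bsub>Q\<^esub>"
    have y: "y \<in> gens g" and w: "w \<in> words g" using Cons.prems by (auto simp: l words_def)
    have l1: "[l] \<in> words g" using y by (simp add: l words_def)
    have "h (word_class g (l # w)) = h (word_class g [l]) \<otimes>\<^bsub>Q\<^esub> h (word_class g w)"
      using word_class_mult[OF l1 w] word_class_in_carrier[OF l1] word_class_in_carrier[OF w]
      by (metis append_Cons append_Nil h.hom_mult)
    also have "h (word_class g [l]) = (\<Otimes>\<^bsub>Q\<^esub>x\<in>gens g. ?a x)"
      using Q.finprod_singleton[OF y fin, of "\<lambda>x. ?p x ?s"] gen by (simp add: l letter[OF y, of e])
    also have "h (word_class g w) = (\<Otimes>\<^bsub>Q\<^esub>x\<in>gens g. ?p x (exponent_sum x w))"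
      by (rule Cons.IH[OF w])
    also have "(\<Otimes>\<^bsub>Q\<^esub>x\<in>gens g. ?a x) \<otimes>\<^bsub>Q\<^esub> \<dots> =
        (\<Otimes>\<^bsub>Q\<^esub>x\<in>gens g. ?a x \<otimes>\<^bsub>Q\<^esub> ?p x (exponent_sum x w))"
      using gen by (intro Q.finprod_multf[symmetric]) auto
    also have "\<dots> = (\<Otimes>\<^bsub>Q\<^esub>x\<in>gens g. ?p x (exponent_sum x (l # w)))"
    proof (rule Q.finprod_cong')
      show "(\<lambda>x. ?p x (exponent_sum x (l # w))) \<in> gens g \<rightarrow> carrier Q" using gen by auto
      show "?a x \<otimes>\<^bsub>Q\<^esub> ?p x (exponent_sum x w) = ?p x (exponent_sum x (l # w))" if "x \<in> gens g" for x
        using gen[OF that] by (simp add: l Q.int_pow_mult)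
    qed simp
    finally show ?case .
  qed
qed

text \<open>The previous lemma, applied to the projection onto the abelianization.\<close>

lemma exponent_sums_zero_imp_derived:
  assumes w: "w \<in> words g" and zero: "\<And>x. x \<in> gens g \<Longrightarrow> exponent_sum x w = 0"
  shows "word_class g w \<in> derived (surface_group g) (carrier (surface_group g))"
proof -
  let ?G = "surface_group g" and ?D = "derived (surface_group g) (carrier (surface_group g))"
  interpret G: group ?G by (rule group_surface_group)
  interpret D: normal ?D ?G using G.derived_is_normal[OF G.normal_self] .
  interpret Q: comm_group "?G Mod ?D" by (rule G.derived_quot_is_comm_group)
  have "?D #>\<^bsub>?G\<^esub> word_class g w = (\<Otimes>\<^bsub>?G Mod ?D\<^esub>x\<in>gens g.
      (?D #>\<^bsub>?G\<^esub> gen_class g x) [^]\<^bsub>?G Mod ?D\<^esub> exponent_sum x w)"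
    by (rule hom_word_class_eq_finprod[OF Q.comm_group_axioms D.r_coset_hom_Mod w])
  also have "\<dots> = \<one>\<^bsub>?G Mod ?D\<^esub>"
    using zero by (intro Q.finprod_one_eqI) simp
  also have "\<dots> = ?D" by (simp add: FactGroup_def)
  finally show ?thesis
    by (rule G.coset_join1[OF _ word_class_in_carrier[OF w] D.subgroup_axioms])
qed

definition class_exponent :: "gen \<Rightarrow> word set \<Rightarrow> int" where
  "class_exponent x \<gamma> = exponent_sum x (SOME w. w \<in> \<gamma>)"

lemma class_exponent_word_class:
  assumes "w \<in> words g" shows "class_exponent x (word_class g w) = exponent_sum x w"
proof -
  define v where "v = (SOME v. v \<in> word_class g w)"
  have "v \<in> word_class g w"
    unfolding v_def by (rule someI) (rule equiv_class_self[OF equiv_surface_rel assms])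
  then have "equivclp (surface_step g) w v" by (simp add: surface_rel_def)
  then show ?thesis unfolding class_exponent_def v_def[symmetric] by (rule exponent_sum_equivclp[symmetric])
qed

lemma class_exponent_mult:
  assumes "\<gamma> \<in> carrier (surface_group g)" "\<delta> \<in> carrier (surface_group g)"
  shows "class_exponent x (\<gamma> \<otimes>\<^bsub>surface_group g\<^esub> \<delta>) = class_exponent x \<gamma> + class_exponent x \<delta>"
proof -
  obtain u v where uv: "u \<in> words g" "\<gamma> = word_class g u" "v \<in> words g" "\<delta> = word_class g v"
    using assms by (auto simp: surface_group_def quotient_def)
  have "u @ v \<in> words g" using uv by (simp add: words_def)
  with uv show ?thesis by (simp add: word_class_mult class_exponent_word_class)
qed

lemma class_exponent_nonzero:
  assumes "\<gamma> \<in> carrier (surface_group g)"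
    and "\<gamma> \<notin> derived (surface_group g) (carrier (surface_group g))"
  obtains x where "class_exponent x \<gamma> \<noteq> 0"
proof -
  obtain w where w: "w \<in> words g" "\<gamma> = word_class g w"
    using assms by (auto simp: surface_group_def quotient_def)
  with assms(2) exponent_sums_zero_imp_derived[OF w(1)] that show thesis
    by (metis class_exponent_word_class)
qed

section \<open>Measures that are permuted by a bijection\<close>

text \<open>For measurable \<open>f\<close> this is the composition rule for push-forwards. For arbitrary \<open>f\<close> the
  push-forward is the zero measure unless its set function is countably additive; the measurable
  left inverse \<open>S\<close> of \<open>T\<close> ensures that the set functions of \<open>f\<close> and of
  \<open>T \<circ> f\<close> are countably additive or not together.\<close>

lemma distr_distr_iso:
  assumes T: "T \<in> measurable N N" and S: "S \<in> measurable N N"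
    and ST: "\<And>x. x \<in> space N \<Longrightarrow> S (T x) = x"
    and f: "f \<in> space M \<rightarrow> space N"
  shows "distr (distr M N f) N T = distr M N (\<lambda>x. T (f x))"
proof -
  let ?\<mu> = "\<lambda>f A. emeasure M (f -` A \<inter> space M)"
  have STf: "S (T (f x)) = f x" if "x \<in> space M" for x
    using f that by (intro ST) auto
  have em: "emeasure (distr M N f) A = (if A \<in> sets N \<and> measure_space (space N) (sets N) (?\<mu> f) then ?\<mu> f A else 0)"
    for f :: "'b \<Rightarrow> 'a" and A
    by (simp add: distr_def emeasure_measure_of_conv sets.sigma_sets_eq)
  have comp: "emeasure (distr (distr M N f) N U) A = ?\<mu> (\<lambda>x. U (f x)) A"
    if m: "measure_space (space N) (sets N) (?\<mu> f)" and U: "U \<in> measurable N N"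
      and f: "f \<in> space M \<rightarrow> space N" and A: "A \<in> sets N" for f U A
  proof -
    have "emeasure (distr (distr M N f) N U) A = emeasure (distr M N f) (U -` A \<inter> space N)"
      using U A by (subst emeasure_distr) auto
    also have "\<dots> = ?\<mu> f (U -` A \<inter> space N)"
      using m U A by (simp add: em)
    also have "f -` (U -` A \<inter> space N) \<inter> space M = (\<lambda>x. U (f x)) -` A \<inter> space M"
      using f by auto
    finally show ?thesis .
  qed
  have trans: "measure_space (space N) (sets N) (?\<mu> (\<lambda>x. U (f x)))"
    if m: "measure_space (space N) (sets N) (?\<mu> f)" and U: "U \<in> measurable N N"
      and f: "f \<in> space M \<rightarrow> space N" for f U
    using measure_space[of "distr (distr M N f) N U"] comp[OF m U f]
      measure_space_eq[OF sets.space_closed[of N], of "emeasure (distr (distr M N f) N U)" "?\<mu> (\<lambda>x. U (f x))"]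
    by (simp add: sets.sigma_sets_eq)
  \<comment> \<open>\<open>T\<close> transports countable additivity forward, \<open>S\<close> transports it back.\<close>
  have iff: "measure_space (space N) (sets N) (?\<mu> f) \<longleftrightarrow>
      measure_space (space N) (sets N) (?\<mu> (\<lambda>x. T (f x)))"
  proof
    assume m: "measure_space (space N) (sets N) (?\<mu> (\<lambda>x. T (f x)))"
    have "measure_space (space N) (sets N) (?\<mu> (\<lambda>x. S (T (f x))))"
      using trans[OF m S] f measurable_space[OF T] by auto
    moreover have "?\<mu> (\<lambda>x. S (T (f x))) A = ?\<mu> f A" for A
      using STf by (intro arg_cong[of _ _ "emeasure M"]) auto
    ultimately show "measure_space (space N) (sets N) (?\<mu> f)" by simp
  qed (rule trans[OF _ T f])
  show ?thesis
  proof (rule measure_eqI)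
    fix A assume "A \<in> sets (distr (distr M N f) N T)"
    then have A: "A \<in> sets N" by simp
    show "emeasure (distr (distr M N f) N T) A = emeasure (distr M N (\<lambda>x. T (f x))) A"
    proof (cases "measure_space (space N) (sets N) (?\<mu> f)")
      case True
      then show ?thesis using comp[OF True T f A] iff A by (simp add: em[of "\<lambda>x. T (f x)"])
    next
      case False
      then have "emeasure (distr (distr M N f) N T) A = 0"
        using T A by (subst emeasure_distr) (auto simp: em)
      then show ?thesis using False iff by (simp add: em[of "\<lambda>x. T (f x)"])
    qed
  qed simp
qed

text \<open>The push-forward of the least upper bound is an upper bound, since each member of the family is
  the push-forward of a member.\<close>

lemma SUP_le_distr_SUP:
  fixes M :: "'i \<Rightarrow> 'a measure"
  assumes "P \<noteq> {}" and sets: "\<And>p. p \<in> P \<Longrightarrow> sets (M p) = sets N"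
    and T: "T \<in> measurable N N"
    and perm: "\<And>p. p \<in> P \<Longrightarrow> \<exists>q\<in>P. M p = distr (M q) N T"
  shows "(SUP p\<in>P. M p) \<le> distr (SUP p\<in>P. M p) N T"
proof (rule SUP_least)
  let ?V = "SUP p\<in>P. M p"
  have V: "sets ?V = sets N" using sets assms(1) by (rule sets_SUP)
  then have T': "T \<in> measurable ?V N" using T by (simp cong: measurable_cong_sets)
  fix p assume p: "p \<in> P"
  then obtain q where q: "q \<in> P" "M p = distr (M q) N T" using perm by blast
  have Tq: "T \<in> measurable (M q) N" using T sets[OF q(1)] by (simp cong: measurable_cong_sets)
  show "M p \<le> distr ?V N T"
  proof (subst le_measure)
    show "sets (M p) = sets (distr ?V N T)" using sets[OF p] by simp
    have "emeasure (M q) (T -` A \<inter> space (M q)) \<le> emeasure ?V (T -` A \<inter> space ?V)" if "A \<in> sets N" for A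
      using le_measureD3[OF SUP_upper[OF q(1), of M]] sets[OF q(1)] V
        sets_eq_imp_space_eq[OF V] sets_eq_imp_space_eq[OF sets[OF q(1)]] by simp
    then show "\<forall>A\<in>sets (M p). emeasure (M p) A \<le> emeasure (distr ?V N T) A"
      using sets[OF p] T' Tq by (simp add: q(2) emeasure_distr)
  qed
qed

text \<open>One inequality is the previous lemma for \<open>T\<close>, the other one is the previous lemma for its
  inverse.\<close>

lemma distr_SUP_eq_SUP:
  fixes M :: "'i \<Rightarrow> 'a measure"
  assumes ne: "P \<noteq> {}" and sets: "\<And>p. p \<in> P \<Longrightarrow> sets (M p) = sets N"
    and T: "T \<in> measurable N N" and S: "S \<in> measurable N N"
    and TS: "\<And>x. x \<in> space N \<Longrightarrow> T (S x) = x" and ST: "\<And>x. x \<in> space N \<Longrightarrow> S (T x) = x"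
    and permT: "\<And>p. p \<in> P \<Longrightarrow> \<exists>q\<in>P. M p = distr (M q) N T"
    and permS: "\<And>p. p \<in> P \<Longrightarrow> \<exists>q\<in>P. M p = distr (M q) N S"
  shows "distr (SUP p\<in>P. M p) N T = (SUP p\<in>P. M p)"
proof (rule antisym)
  let ?V = "SUP p\<in>P. M p"
  have V: "sets ?V = sets N" using sets ne by (rule sets_SUP)
  note sp = sets_eq_imp_space_eq[OF V]
  have T': "T \<in> measurable ?V N" and S': "S \<in> measurable ?V N"
    using T S V by (simp_all cong: measurable_cong_sets)
  show "?V \<le> distr ?V N T" using ne sets T permT by (rule SUP_le_distr_SUP)
  have *: "?V \<le> distr ?V N S" using ne sets S permS by (rule SUP_le_distr_SUP)
  have "emeasure (distr ?V N T) A \<le> emeasure ?V A" if A: "A \<in> sets N" for A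
  proof -
    \<comment> \<open>The bound for \<open>S\<close>, applied to the preimage of \<open>A\<close> under \<open>T\<close>.\<close>
    let ?B = "T -` A \<inter> space N"
    have B: "?B \<in> sets N" using A T by simp
    have "S -` ?B \<inter> space N = A"
      using TS ST measurable_space[OF S] sets.sets_into_space[OF A] by auto
    then have "emeasure ?V ?B \<le> emeasure ?V A"
      using le_measureD3[OF *, of ?B] V S' B by (simp add: emeasure_distr sp)
    then show ?thesis using T' A by (simp add: emeasure_distr sp)
  qed
  then show "distr ?V N T \<le> ?V" by (subst le_measure) (simp_all add: V)
qed

section \<open>Scalar multiples of special unitary matrices\<close>

lemma SU_iff:
  "A \<in> carrier (SU n) \<longleftrightarrow> A \<in> carrier_mat n n \<and> A * mat_adjoint A = 1\<^sub>m n \<and> det A = 1"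
  by (simp add: SU_def)

lemma SU_carrier_mat: "A \<in> carrier (SU n) \<Longrightarrow> A \<in> carrier_mat n n"
  by (simp add: SU_iff)

lemma SU_mult [simp]: "A \<otimes>\<^bsub>SU n\<^esub> B = A * B"
  by (simp add: SU_def)

lemma SU_inv_eq_adjoint:
  assumes A: "A \<in> carrier (SU n)" shows "inv\<^bsub>SU n\<^esub> A = mat_adjoint A"
proof -
  interpret group "SU n" by (rule group_SU)
  have iA: "inv\<^bsub>SU n\<^esub> A \<in> carrier_mat n n" using A by (simp add: SU_carrier_mat)
  have "inv\<^bsub>SU n\<^esub> A * A = 1\<^sub>m n" using l_inv[OF A] by (simp add: SU_def)
  moreover have "inv\<^bsub>SU n\<^esub> A * A * mat_adjoint A = inv\<^bsub>SU n\<^esub> A * (A * mat_adjoint A)"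
    using A iA by (intro assoc_mult_mat[of _ n n _ n _ n]) (auto simp: SU_iff mat_adjoint_carrier)
  ultimately show ?thesis
    using A iA by (simp add: SU_iff mat_adjoint_carrier left_mult_one_mat[of _ n n])
qed

lemma SU_inv_carrier_mat: "A \<in> carrier (SU n) \<Longrightarrow> inv\<^bsub>SU n\<^esub> A \<in> carrier_mat n n"
  using group.inv_closed[OF group_SU] SU_carrier_mat by blast

lemma su_carrier_mat: "X \<in> su n \<Longrightarrow> X \<in> carrier_mat n n"
  by (simp add: su_def)

lemma smult_smult_mat: "a \<cdot>\<^sub>m (b \<cdot>\<^sub>m A) = (a * b :: complex) \<cdot>\<^sub>m A"
  by (intro eq_matI) (auto simp: mult.assoc)

lemma one_smult_mat: "(1 :: complex) \<cdot>\<^sub>m A = A"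
  by (intro eq_matI) auto

lemma mat_adjoint_smult: "mat_adjoint (z \<cdot>\<^sub>m A) = cnj z \<cdot>\<^sub>m mat_adjoint A"
  by (intro eq_matI) (auto simp: mat_adjoint_index mat_adjoint_dim conjugate_complex_def)

lemma root_of_unity_mult_cnj:
  assumes "z ^ n = 1" "n > 0" shows "z * cnj z = (1 :: complex)"
  using power_eq_1_iff[of z n] assms by (simp add: complex_norm_square[symmetric])

lemma smult_in_SU:
  assumes z: "z ^ n = 1" "n > 0" and A: "A \<in> carrier (SU n)"
  shows "z \<cdot>\<^sub>m A \<in> carrier (SU n)"
proof -
  have c: "A \<in> carrier_mat n n" "mat_adjoint A \<in> carrier_mat n n"
    using A by (auto simp: SU_iff mat_adjoint_carrier)
  have "(z \<cdot>\<^sub>m A) * mat_adjoint (z \<cdot>\<^sub>m A) = (z * cnj z) \<cdot>\<^sub>m (A * mat_adjoint A)"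
    using c by (simp add: mat_adjoint_smult mult_smult_distrib[of _ n n _ n]
        mult_smult_assoc_mat[of _ n n _ n] smult_smult_mat mult.commute)
  then show ?thesis
    using A c z root_of_unity_mult_cnj[OF z] by (simp add: SU_iff one_smult_mat)
qed

text \<open>The scalar cancels against its inverse. With a derivative of matrices for \<open>B\<close> this shows that
  tangent vectors moved to the Lie algebra do not change under multiplication by a root of unity.\<close>

lemma smult_mult_inv_smult:
  assumes z: "z ^ n = 1" "n > 0" and A: "A \<in> carrier (SU n)" and B: "B \<in> carrier_mat n n"
  shows "(z \<cdot>\<^sub>m B) * inv\<^bsub>SU n\<^esub> (z \<cdot>\<^sub>m A) = B * inv\<^bsub>SU n\<^esub> A"
proof -
  have c: "mat_adjoint A \<in> carrier_mat n n"
    using A by (auto simp: SU_iff mat_adjoint_carrier)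
  have "(z \<cdot>\<^sub>m B) * inv\<^bsub>SU n\<^esub> (z \<cdot>\<^sub>m A) = (z * cnj z) \<cdot>\<^sub>m (B * mat_adjoint A)"
    using c B by (simp add: SU_inv_eq_adjoint[OF smult_in_SU[OF z A]] mat_adjoint_smult
        mult_smult_distrib[of _ n n _ n] mult_smult_assoc_mat[of _ n n _ n] smult_smult_mat mult.commute)
  then show ?thesis
    by (simp add: root_of_unity_mult_cnj[OF z] one_smult_mat SU_inv_eq_adjoint[OF A])
qed

lemma Ad_smult:
  assumes z: "z ^ n = 1" "n > 0" and A: "A \<in> carrier (SU n)" and X: "X \<in> carrier_mat n n"
  shows "Ad n (z \<cdot>\<^sub>m A) X = Ad n A X"
  using smult_mult_inv_smult[OF z A, of "A * X"] SU_carrier_mat[OF A] X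
  by (simp add: Ad_def mult_smult_assoc_mat[of _ n n _ n])

lemma mat_trace_smult: "mat_trace (z \<cdot>\<^sub>m A) = z * mat_trace A" if "A \<in> carrier_mat n n"
  using that by (simp add: mat_trace_def sum_distrib_left)

lemma mat_trace_mult_commute:
  assumes "A \<in> carrier_mat n n" "B \<in> carrier_mat n n"
  shows "mat_trace (A * B) = mat_trace (B * A)"
proof -
  have "mat_trace (A * B) = (\<Sum>i<n. \<Sum>k<n. A $$ (i, k) * B $$ (k, i))"
    using assms by (simp add: mat_trace_def scalar_prod_def atLeast0LessThan)
  also have "\<dots> = (\<Sum>k<n. \<Sum>i<n. B $$ (k, i) * A $$ (i, k))"
    by (subst sum.swap) (simp add: mult.commute)
  also have "\<dots> = mat_trace (B * A)"
    using assms by (simp add: mat_trace_def scalar_prod_def atLeast0LessThan)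
  finally show ?thesis .
qed

lemma mat_trace_conj:
  assumes A: "A \<in> carrier (SU n)" and B: "B \<in> carrier_mat n n"
  shows "mat_trace (A * B * inv\<^bsub>SU n\<^esub> A) = mat_trace B"
proof -
  have c: "A \<in> carrier_mat n n" "inv\<^bsub>SU n\<^esub> A \<in> carrier_mat n n"
    using A by (auto simp: SU_carrier_mat SU_inv_carrier_mat)
  have "mat_trace (A * B * inv\<^bsub>SU n\<^esub> A) = mat_trace (inv\<^bsub>SU n\<^esub> A * (A * B))"
    using c B by (intro mat_trace_mult_commute) auto
  also have "inv\<^bsub>SU n\<^esub> A * (A * B) = inv\<^bsub>SU n\<^esub> A * A * B"
    using c B by (simp add: assoc_mult_mat[of _ n n _ n _ n])
  also have "inv\<^bsub>SU n\<^esub> A * A = 1\<^sub>m n"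
    using group.l_inv[OF group_SU A] by (simp add: SU_def)
  finally show ?thesis using B by simp
qed

section \<open>Smooth functions on open sets\<close>

lemma openin_euclid_imp_extensional:
  assumes "openin (euclid d) U" "x \<in> U" shows "x \<in> extensional {..<d}"
  using openin_subset[OF assms(1)] assms(2) by (auto simp: euclid_def PiE_def)

lemma eventually_fun_upd_in_open:
  assumes U: "openin (euclid d) U" and x: "x \<in> U" and i: "i < d"
  shows "\<forall>\<^sub>F t in nhds (x i). x(i := t) \<in> U"
proof -
  have ext: "x \<in> extensional {..<d}" using U x by (rule openin_euclid_imp_extensional)
  have "continuous_map euclidean (euclid d) (\<lambda>t. x(i := t))"
    unfolding euclid_def continuous_map_componentwise
  proof (intro conjI ballI)
    show "(\<lambda>t. x(i := t)) ` topspace euclidean \<subseteq> extensional {..<d}"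
      using ext i by (auto simp: extensional_def)
    show "continuous_map euclidean euclidean (\<lambda>t. (x(i := t)) k)" for k
      by (cases "k = i") (auto simp: continuous_on_id)
  qed
  then have "open {t. x(i := t) \<in> U}"
    using openin_continuous_map_preimage[OF _ U] by fastforce
  then show ?thesis
    using x by (intro eventually_nhds[THEN iffD2] exI[of _ "{t. x(i := t) \<in> U}"]) auto
qed

lemma differentiable_cong_eventually:
  fixes f g :: "real \<Rightarrow> 'a :: real_normed_vector"
  assumes ev: "\<forall>\<^sub>F t in nhds a. f t = g t"
  shows "f differentiable at a \<longleftrightarrow> g differentiable at a"
proof -
  have "(f has_vector_derivative D) (at a) \<longleftrightarrow> (g has_vector_derivative D) (at a)" for D
    using ev eventually_nhds_x_imp_x[OF ev] by (intro has_vector_derivative_cong_ev) auto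
  then show ?thesis by (metis differentiableI_vector vector_derivative_works)
qed

lemma continuous_map_mult_left_complex:
  fixes f :: "'x \<Rightarrow> complex"
  assumes "continuous_map X euclidean f" shows "continuous_map X euclidean (\<lambda>x. c * f x)"
  using continuous_map_compose[OF assms, of euclidean "\<lambda>z. c * z"]
  by (simp add: o_def continuous_on_mult_left continuous_on_id)

lemma C_k_on_mult_left:
  assumes U: "openin (euclid d) U" and f: "C_k_on k d U f" and h: "\<And>x. x \<in> U \<Longrightarrow> h x = c * f x"
  shows "C_k_on k d U h"
  using f h
proof (induction k arbitrary: f h)
  case (0 f h)
  have "continuous_map (subtopology (euclid d) U) euclidean (\<lambda>x. c * f x)"
    using 0 by (intro continuous_map_mult_left_complex) simp
  then show ?case using 0(2) by (auto elim!: continuous_map_eq)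
next
  case (Suc k f h)
  have "continuous_map (subtopology (euclid d) U) euclidean (\<lambda>x. c * f x)"
    using Suc.prems by (intro continuous_map_mult_left_complex) simp
  then have 1: "continuous_map (subtopology (euclid d) U) euclidean h"
    using Suc.prems(2) by (auto elim!: continuous_map_eq)
  have 2: "((\<lambda>t. h (x(i := t))) has_vector_derivative c * partial_deriv i f x) (at (x i))"
    if x: "x \<in> U" and i: "i < d" for x i
  proof -
    \<comment> \<open>The hypothesis speaks of \<open>U\<close> only; as \<open>U\<close> is open, it applies near \<open>x\<close> on the coordinate line.\<close>
    have ev: "\<forall>\<^sub>F t in nhds (x i). h (x(i := t)) = c * f (x(i := t))"
      using eventually_fun_upd_in_open[OF U x i] by eventually_elim (rule Suc.prems(2))
    have "((\<lambda>t. f (x(i := t))) has_vector_derivative partial_deriv i f x) (at (x i))"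
      using Suc.prems(1) x i by (simp add: partial_deriv_def vector_derivative_works[symmetric])
    then have "((\<lambda>t. c * f (x(i := t))) has_vector_derivative c * partial_deriv i f x) (at (x i))"
      by (rule has_vector_derivative_mult_right)
    then show ?thesis
      using ev eventually_nhds_x_imp_x[OF ev] by (subst has_vector_derivative_cong_ev) auto
  qed
  have "C_k_on k d U (partial_deriv i h)" if i: "i < d" for i
  proof (rule Suc.IH)
    show "C_k_on k d U (partial_deriv i f)" using Suc.prems(1) i by simp
    show "partial_deriv i h x = c * partial_deriv i f x" if "x \<in> U" for x
      using vector_derivative_at[OF 2[OF that i]] by (simp add: partial_deriv_def[of i h])
  qed
  with 1 2 show ?case by (auto intro: differentiableI_vector)
qed

section \<open>Representations and their parametrizations\<close>

lemma rep_space_SU: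
  assumes "\<phi> \<in> rep_space g n" "\<gamma> \<in> carrier (surface_group g)" shows "\<phi> \<gamma> \<in> carrier (SU n)"
  using assms by (auto simp: rep_space_def hom_def)

lemma rep_space_mult:
  assumes "\<phi> \<in> rep_space g n" "\<gamma> \<in> carrier (surface_group g)" "\<delta> \<in> carrier (surface_group g)"
  shows "\<phi> (\<gamma> \<otimes>\<^bsub>surface_group g\<^esub> \<delta>) = \<phi> \<gamma> * \<phi> \<delta>"
  using assms by (auto simp: rep_space_def hom_def)

text \<open>A parametrization is required to be smooth on the generators only. Differentiability on all
  group elements follows because products and inverses (which are adjoints) of unitary matrices are
  polynomial in the entries and their conjugates.\<close>

lemma rep_word_entry_differentiable:
  fixes F :: "real \<Rightarrow> rep"
  assumes ev: "\<forall>\<^sub>F t in nhds a. F t \<in> rep_space g n"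
    and gens: "\<And>x r s. x \<in> gens g \<Longrightarrow> r < n \<Longrightarrow> s < n \<Longrightarrow> (\<lambda>t. F t (gen_class g x) $$ (r, s)) differentiable at a"
    and w: "w \<in> words g" and rs: "r < n" "s < n"
  shows "(\<lambda>t. F t (word_class g w) $$ (r, s)) differentiable at a"
  using w rs
proof (induction w arbitrary: r s)
  case Nil
  have "\<forall>\<^sub>F t in nhds a. F t (word_class g []) $$ (r, s) = 1\<^sub>m n $$ (r, s)"
    using ev
  proof eventually_elim
    case (elim t)
    interpret group_hom "surface_group g" "SU n" "F t"
      using elim by (intro group_hom.intro group_hom_axioms.intro group_surface_group group_SU)
        (simp add: rep_space_def)
    show ?case using hom_one by (simp add: surface_group_def SU_def)
  qed
  from differentiable_cong_eventually[OF this] show ?case by simp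
next
  case (Cons l w)
  obtain x e where l: "l = (x, e)" by force
  have x: "x \<in> gens g" and w: "w \<in> words g" using Cons.prems by (auto simp: l words_def)
  have l1: "[l] \<in> words g" using x by (simp add: l words_def)
  note c = word_class_in_carrier[OF l1] word_class_in_carrier[OF w]
  have letter: "(\<lambda>t. F t (word_class g [l]) $$ (r, s)) differentiable at a" if rs: "r < n" "s < n" for r s
  proof (cases e)
    case True
    then show ?thesis using gens x rs by (simp add: l)
  next
    case False
    have "\<forall>\<^sub>F t in nhds a. F t (word_class g [l]) $$ (r, s) = cnj (F t (gen_class g x) $$ (s, r))"
      using ev
    proof eventually_elim
      case (elim t)
      interpret group_hom "surface_group g" "SU n" "F t"
        using elim by (intro group_hom.intro group_hom_axioms.intro group_surface_group group_SU)
          (simp add: rep_space_def)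
      have S: "F t (gen_class g x) \<in> carrier (SU n)" by (rule rep_space_SU[OF elim gen_class_carrier[OF x]])
      have "F t (word_class g [l]) = mat_adjoint (F t (gen_class g x))"
        using x S by (simp add: l False word_class_inverse_letter gen_class_carrier SU_inv_eq_adjoint)
      then show ?case
        using SU_carrier_mat[OF S] rs by (simp add: mat_adjoint_index conjugate_complex_def)
    qed
    moreover have "(\<lambda>t. cnj (F t (gen_class g x) $$ (s, r))) differentiable at a"
      using bounded_linear.has_vector_derivative[OF bounded_linear_cnj] gens[OF x rs(2,1)]
      by (metis differentiableI_vector vector_derivative_works)
    ultimately show ?thesis using differentiable_cong_eventually by fast
  qed
  have "\<forall>\<^sub>F t in nhds a. F t (word_class g (l # w)) $$ (r, s) =
      (\<Sum>k<n. F t (word_class g [l]) $$ (r, k) * F t (word_class g w) $$ (k, s))"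
    using ev
  proof eventually_elim
    case (elim t)
    have S: "F t (word_class g [l]) \<in> carrier_mat n n" "F t (word_class g w) \<in> carrier_mat n n"
      using rep_space_SU[OF elim] c by (auto intro: SU_carrier_mat)
    have "F t (word_class g (l # w)) = F t (word_class g [l]) * F t (word_class g w)"
      using rep_space_mult[OF elim c] by (simp add: word_class_mult[OF l1 w])
    then show ?case using S Cons.prems by (simp add: scalar_prod_def atLeast0LessThan)
  qed
  moreover have "(\<lambda>t. \<Sum>k<n. F t (word_class g [l]) $$ (r, k) * F t (word_class g w) $$ (k, s)) differentiable at a"
    using letter Cons.IH[OF w] Cons.prems by (intro differentiable_sum) (auto intro!: differentiable_mult)
  ultimately show ?case using differentiable_cong_eventually by fast
qed

lemma moduli_parametrization_irr:
  assumes "moduli_parametrization g n U f" "y \<in> U" shows "f y \<in> irr_space g n"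
  using assms by (auto simp: moduli_parametrization_def)

lemma moduli_parametrization_entry_differentiable:
  assumes par: "moduli_parametrization g n U f" and x: "x \<in> U" and i: "i < moduli_dim g n"
    and \<gamma>: "\<gamma> \<in> carrier (surface_group g)" and rs: "r < n" "s < n"
  shows "(\<lambda>t. f (x(i := t)) \<gamma> $$ (r, s)) differentiable at (x i)"
proof -
  obtain w where w: "w \<in> words g" "\<gamma> = word_class g w"
    using \<gamma> by (auto simp: surface_group_def quotient_def)
  have U: "openin (euclid (moduli_dim g n)) U" using par by (simp add: moduli_parametrization_def)
  have gen: "(\<lambda>t. f (x(i := t)) (gen_class g z) $$ (r, s)) differentiable at (x i)"
    if "z \<in> gens g" "r < n" "s < n" for z r s
  proof -
    have "C_k_on (Suc 0) (moduli_dim g n) U (\<lambda>y. f y (gen_class g z) $$ (r, s))"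
      using par that unfolding moduli_parametrization_def smooth_mat_on_def by blast
    then show ?thesis using x i by simp
  qed
  have ev: "\<forall>\<^sub>F t in nhds (x i). f (x(i := t)) \<in> rep_space g n"
    using eventually_fun_upd_in_open[OF U x i]
    by eventually_elim (use moduli_parametrization_irr[OF par] in \<open>auto simp: irr_space_def\<close>)
  show ?thesis
    unfolding w(2) by (rule rep_word_entry_differentiable[OF ev gen w(1) rs])
qed

lemma moduli_trace_conj_orbit:
  assumes \<phi>: "\<phi> \<in> rep_space g n" and \<gamma>: "\<gamma> \<in> carrier (surface_group g)"
  shows "moduli_trace \<gamma> (conj_orbit g n \<phi>) = mat_trace (\<phi> \<gamma>)"
proof -
  have tr: "mat_trace (\<psi> \<gamma>) = mat_trace (\<phi> \<gamma>)" if "\<psi> \<in> conj_orbit g n \<phi>" for \<psi>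
    using that \<gamma> SU_carrier_mat[OF rep_space_SU[OF \<phi> \<gamma>]]
    by (auto simp: conj_orbit_def mat_trace_conj)
  have "\<one>\<^bsub>SU n\<^esub> \<in> carrier (SU n)" by (rule monoid.one_closed[OF group.is_monoid[OF group_SU]])
  then have "conj_orbit g n \<phi> \<noteq> {}" by (auto simp: conj_orbit_def)
  with tr show ?thesis unfolding moduli_trace_def by (intro the_equality) fastforce+
qed

section \<open>Topologies on representations and on the moduli space\<close>

lemma topspace_SU_topology: "topspace (SU_topology n) = carrier (SU n)"
  by (auto simp: SU_topology_def topspace_pullback_topology)

lemma topspace_irr_topology: "topspace (irr_topology g n) = irr_space g n"
  by (auto simp: irr_topology_def topspace_pullback_topology topspace_SU_topology irr_space_def
      gen_class_carrier intro!: rep_space_SU)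

lemma topspace_moduli_topology: "topspace (moduli_topology g n) = moduli g n"
proof
  show "topspace (moduli_topology g n) \<subseteq> moduli g n"
    using openin_topspace[of "moduli_topology g n"] unfolding openin_moduli_topology by blast
  have "{\<phi> \<in> irr_space g n. conj_orbit g n \<phi> \<in> moduli g n} = topspace (irr_topology g n)"
    by (auto simp: topspace_irr_topology moduli_def)
  then have "openin (moduli_topology g n) (moduli g n)"
    by (simp add: openin_moduli_topology)
  then show "moduli g n \<subseteq> topspace (moduli_topology g n)" by (rule openin_subset)
qed

lemma continuous_map_irr_entry:
  assumes "x \<in> gens g" "i < n" "j < n"
  shows "continuous_map (irr_topology g n) euclidean (\<lambda>\<phi>. \<phi> (gen_class g x) $$ (i, j))"
proof -
  have "continuous_map (SU_topology n) euclidean ((\<lambda>f. f (i, j)) \<circ> (\<lambda>A. restrict (($$) A) ({..<n} \<times> {..<n})))"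
    unfolding SU_topology_def using assms
    by (intro continuous_map_pullback continuous_map_product_projection) auto
  then have "continuous_map (product_topology (\<lambda>_. SU_topology n) (gens g)) euclidean
      (((\<lambda>f. f (i, j)) \<circ> (\<lambda>A. restrict (($$) A) ({..<n} \<times> {..<n}))) \<circ> (\<lambda>F. F x))"
    using assms by (intro continuous_map_compose[OF continuous_map_product_projection]) auto
  then have "continuous_map (irr_topology g n) euclidean
      ((((\<lambda>f. f (i, j)) \<circ> (\<lambda>A. restrict (($$) A) ({..<n} \<times> {..<n}))) \<circ> (\<lambda>F. F x)) \<circ>
        (\<lambda>\<phi>. \<lambda>x\<in>gens g. \<phi> (gen_class g x)))"
    unfolding irr_topology_def by (rule continuous_map_pullback)
  then show ?thesis using assms by (simp add: o_def)
qed

text \<open>Conversely, the entries on the generators determine the topology, so they suffice to test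
  continuity.\<close>

lemma continuous_map_into_irr_topology:
  assumes F: "F \<in> topspace X \<rightarrow> irr_space g n"
    and entry: "\<And>x i j. x \<in> gens g \<Longrightarrow> i < n \<Longrightarrow> j < n \<Longrightarrow>
      continuous_map X euclidean (\<lambda>p. F p (gen_class g x) $$ (i, j))"
  shows "continuous_map X (irr_topology g n) F"
proof -
  have SU: "continuous_map X (SU_topology n) (\<lambda>p. F p (gen_class g x))" if x: "x \<in> gens g" for x
    unfolding SU_topology_def
  proof (rule continuous_map_pullback')
    show "continuous_map X (product_topology (\<lambda>_. euclidean) ({..<n} \<times> {..<n}))
        ((\<lambda>A. restrict (($$) A) ({..<n} \<times> {..<n})) \<circ> (\<lambda>p. F p (gen_class g x)))"
      using entry[OF x] by (auto simp: continuous_map_componentwise)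
    show "topspace X \<subseteq> (\<lambda>p. F p (gen_class g x)) -` carrier (SU n)"
      using F x by (auto simp: irr_space_def intro!: rep_space_SU gen_class_carrier)
  qed
  show ?thesis
    unfolding irr_topology_def
  proof (rule continuous_map_pullback')
    show "continuous_map X (product_topology (\<lambda>_. SU_topology n) (gens g))
        ((\<lambda>\<phi>. \<lambda>x\<in>gens g. \<phi> (gen_class g x)) \<circ> F)"
      using SU by (auto simp: continuous_map_componentwise)
    show "topspace X \<subseteq> F -` irr_space g n" using F by auto
  qed
qed

section \<open>Dependence of the symplectic volume on its ingredients\<close>

lemma fundamental_eval_cong:
  assumes "\<And>x y. x \<in> carrier (surface_group g) \<Longrightarrow> y \<in> carrier (surface_group g) \<Longrightarrow> c x y = c' x y"
  shows "fundamental_eval g c = fundamental_eval g c'"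
  unfolding fundamental_eval_def
proof (intro sum.cong refl)
  fix k assume "k \<in> {..<length (relator g)}"
  then have k: "k < length (relator g)" by simp
  obtain x e where xe: "relator g ! k = (x, e)" by force
  have "(x, e) \<in> set (relator g)" using k xe nth_mem by metis
  then have x: "x \<in> gens g" using relator_words by (auto simp: words_def)
  have w: "take m (relator g) \<in> words g" for m
    using relator_words[of g] by (auto simp: words_def dest: in_set_takeD)
  show "(case relator g ! k of (x, e) \<Rightarrow>
      if e then c (word_class g (take k (relator g))) (gen_class g x)
      else - c (word_class g (take (Suc k) (relator g))) (gen_class g x)) =
    (case relator g ! k of (x, e) \<Rightarrow>
      if e then c' (word_class g (take k (relator g))) (gen_class g x)
      else - c' (word_class g (take (Suc k) (relator g))) (gen_class g x))"
    unfolding xe using assms[OF word_class_in_carrier[OF w] gen_class_carrier[OF x]] by simp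
qed

lemma wedge_power_cong:
  assumes "\<And>i j. i < 2 * k \<Longrightarrow> j < 2 * k \<Longrightarrow> \<omega> (v i) (v j) = \<omega>' (v' i) (v' j)"
  shows "wedge_power k \<omega> v = wedge_power k \<omega>' v'"
proof -
  have "\<omega> (v (p (2 * i))) (v (p (2 * i + 1))) = \<omega>' (v' (p (2 * i))) (v' (p (2 * i + 1)))"
    if "p permutes {..<2 * k}" "i < k" for p i
    using permutes_in_image[OF that(1), of "2 * i"] permutes_in_image[OF that(1), of "2 * i + 1"] that(2)
    by (intro assms) simp_all
  then show ?thesis unfolding wedge_power_def by (auto intro!: sum.cong prod.cong)
qed

lemma H1_basis_cong:
  assumes "\<And>i. i < moduli_dim g n \<Longrightarrow> u i = v i"
  shows "H1_basis g n \<phi> u \<longleftrightarrow> H1_basis g n \<phi> v"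
proof -
  have "real_lincomb n (moduli_dim g n) c (\<lambda>i. u i \<gamma>) = real_lincomb n (moduli_dim g n) c (\<lambda>i. v i \<gamma>)"
    for c \<gamma>
    using assms by (simp add: real_lincomb_def)
  then show ?thesis using assms by (simp add: H1_basis_def)
qed

lemma cohom_class_carrier_mat:
  assumes \<phi>: "\<phi> \<in> rep_space g n" and u: "\<And>\<gamma>. \<gamma> \<in> carrier (surface_group g) \<Longrightarrow> u \<gamma> \<in> carrier_mat n n"
    and v: "v \<in> cohom_class g n \<phi> u" and \<gamma>: "\<gamma> \<in> carrier (surface_group g)"
  shows "v \<gamma> \<in> carrier_mat n n"
proof -
  obtain X where X: "X \<in> su n" "v \<gamma> = u \<gamma> + coboundary g n \<phi> X \<gamma>"
    using v \<gamma> by (auto simp: cohom_class_def)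
  have "\<phi> \<gamma> \<in> carrier (SU n)" by (rule rep_space_SU[OF \<phi> \<gamma>])
  then have "coboundary g n \<phi> X \<gamma> \<in> carrier_mat n n"
    using su_carrier_mat[OF X(1)] \<gamma> SU_carrier_mat SU_inv_carrier_mat
    by (auto simp: coboundary_def Ad_def intro!: minus_carrier_mat mult_carrier_mat)
  then show ?thesis using u[OF \<gamma>] by (simp add: X(2))
qed

lemma density_measure_cong_chart:
  assumes "\<And>x. x \<in> U \<Longrightarrow> \<rho> x = \<rho>' x" "\<And>x. x \<in> U \<Longrightarrow> f x = f' x" and "sets N = sets N'"
  shows "distr (density (restrict_space M U) (\<lambda>x. ennreal (\<rho> x))) N f =
    distr (density (restrict_space M U) (\<lambda>x. ennreal (\<rho>' x))) N' f'"
proof (rule distr_cong)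
  have "(\<integral>\<^sup>+x. ennreal (\<rho> x) * indicator A x \<partial>restrict_space M U) =
      (\<integral>\<^sup>+x. ennreal (\<rho>' x) * indicator A x \<partial>restrict_space M U)" for A
    using assms(1) by (intro nn_integral_cong) (simp add: space_restrict_space)
  then show "density (restrict_space M U) (\<lambda>x. ennreal (\<rho> x)) =
      density (restrict_space M U) (\<lambda>x. ennreal (\<rho>' x))"
    by (simp add: density_def)
qed (use assms in \<open>auto simp: space_restrict_space\<close>)

definition moduli_borel :: "nat \<Rightarrow> nat \<Rightarrow> rep set measure" where
  "moduli_borel g n = sigma (topspace (moduli_topology g n)) {V. openin (moduli_topology g n) V}"

lemma space_moduli_borel [simp]: "space (moduli_borel g n) = moduli g n"
  by (simp add: moduli_borel_def space_measure_of_conv topspace_moduli_topology)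

lemma sets_moduli_borel:
  "sets (moduli_borel g n) = sigma_sets (moduli g n) {V. openin (moduli_topology g n) V}"
  unfolding moduli_borel_def topspace_moduli_topology[symmetric]
  by (rule sets_measure_of) (auto dest: openin_subset)

definition chart_measure :: "nat \<Rightarrow> nat \<Rightarrow> (nat \<Rightarrow> real) set \<times> ((nat \<Rightarrow> real) \<Rightarrow> rep) \<Rightarrow> rep set measure" where
  "chart_measure g n = (\<lambda>(U, f).
    distr (density (restrict_space (Pi\<^sub>M {..<moduli_dim g n} (\<lambda>_. lborel)) U)
        (\<lambda>x. ennreal (\<bar>wedge_power (moduli_dim g n div 2) (ABG_form g n (f x))
          (\<lambda>i. cohom_class g n (f x) (tangent_cocycle g n f x i))\<bar> / fact (moduli_dim g n))))
      (moduli_borel g n)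
      (\<lambda>x. conj_orbit g n (f x)))"

lemma sets_chart_measure: "sets (chart_measure g n p) = sets (moduli_borel g n)"
  by (simp add: chart_measure_def split_beta)

lemma moduli_volume_eq_SUP:
  "moduli_volume g n = (SUP p\<in>{(U, f). moduli_parametrization g n U f}. chart_measure g n p)"
proof -
  have image: "{F U f | U f. R U f} = (\<lambda>(U, f). F U f) ` {(U, f). R U f}"
    for F :: "'u \<Rightarrow> 'f \<Rightarrow> 'c" and R
    by auto
  show ?thesis
    unfolding moduli_volume_def density_measure_def chart_measure_def moduli_borel_def image image_image
    by (simp only: split_beta fst_conv snd_conv)
qed

section \<open>Twisting by a central character\<close>

definition twist :: "nat \<Rightarrow> (word set \<Rightarrow> complex) \<Rightarrow> rep \<Rightarrow> rep" where
  "twist g \<xi> \<phi> = (\<lambda>\<gamma>\<in>carrier (surface_group g). \<xi> \<gamma> \<cdot>\<^sub>m \<phi> \<gamma>)"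

text \<open>The values of \<open>\<xi>\<close>, read as scalar matrices, lie in the centre of \<open>SU n\<close>.\<close>

locale central_character =
  fixes g n :: nat and \<xi> :: "word set \<Rightarrow> complex"
  assumes n_pos: "n > 0"
    and root: "\<gamma> \<in> carrier (surface_group g) \<Longrightarrow> \<xi> \<gamma> ^ n = 1"
    and char_mult: "\<gamma> \<in> carrier (surface_group g) \<Longrightarrow> \<delta> \<in> carrier (surface_group g) \<Longrightarrow>
      \<xi> (\<gamma> \<otimes>\<^bsub>surface_group g\<^esub> \<delta>) = \<xi> \<gamma> * \<xi> \<delta>"
begin

lemma central_character_inverse: "central_character g n (\<lambda>\<gamma>. inverse (\<xi> \<gamma>))"
  by unfold_locales (simp_all add: n_pos root char_mult power_inverse)

lemma char_nonzero: "\<gamma> \<in> carrier (surface_group g) \<Longrightarrow> \<xi> \<gamma> \<noteq> 0"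
  using root[of \<gamma>] n_pos by (auto simp: power_0_left)

lemma twist_apply: "\<gamma> \<in> carrier (surface_group g) \<Longrightarrow> twist g \<xi> \<phi> \<gamma> = \<xi> \<gamma> \<cdot>\<^sub>m \<phi> \<gamma>"
  by (simp add: twist_def)

lemma twist_in_rep_space:
  assumes \<phi>: "\<phi> \<in> rep_space g n" shows "twist g \<xi> \<phi> \<in> rep_space g n"
proof -
  interpret group "surface_group g" by (rule group_surface_group)
  have "twist g \<xi> \<phi> \<in> hom (surface_group g) (SU n)"
  proof (rule homI)
    fix \<gamma> assume \<gamma>: "\<gamma> \<in> carrier (surface_group g)"
    then show "twist g \<xi> \<phi> \<gamma> \<in> carrier (SU n)"
      using rep_space_SU[OF \<phi>] root n_pos by (simp add: twist_apply smult_in_SU)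
    fix \<delta> assume \<delta>: "\<delta> \<in> carrier (surface_group g)"
    have c: "\<phi> \<gamma> \<in> carrier_mat n n" "\<phi> \<delta> \<in> carrier_mat n n"
      using rep_space_SU[OF \<phi>] \<gamma> \<delta> by (auto intro: SU_carrier_mat)
    show "twist g \<xi> \<phi> (\<gamma> \<otimes>\<^bsub>surface_group g\<^esub> \<delta>) = twist g \<xi> \<phi> \<gamma> \<otimes>\<^bsub>SU n\<^esub> twist g \<xi> \<phi> \<delta>"
      using c \<gamma> \<delta> by (simp add: twist_apply rep_space_mult[OF \<phi>] char_mult
          mult_smult_distrib[of _ n n _ n] mult_smult_assoc_mat[of _ n n _ n] smult_smult_mat mult.commute)
  qed
  then show ?thesis by (simp add: rep_space_def twist_def)
qed

lemma twist_irreducible: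
  assumes \<phi>: "\<phi> \<in> rep_space g n" and irr: "irreducible_rep g n \<phi>"
  shows "irreducible_rep g n (twist g \<xi> \<phi>)"
  unfolding irreducible_rep_def
proof (intro conjI allI impI)
  fix W
  assume W: "VectorSpace.subspace class_ring W (module_vec TYPE(complex) n) \<and>
    (\<forall>\<gamma>\<in>carrier (surface_group g). \<forall>w\<in>W. twist g \<xi> \<phi> \<gamma> *\<^sub>v w \<in> W)"
  have "\<phi> \<gamma> *\<^sub>v w \<in> W" if \<gamma>: "\<gamma> \<in> carrier (surface_group g)" and w: "w \<in> W" for \<gamma> w
  proof -
    have sub: "LinearCombinations.submodule class_ring W (module_vec TYPE(complex) n)"
      using W by (simp add: VectorSpace.subspace_def)
    then have wc: "w \<in> carrier_vec n"
      using w by (auto simp: LinearCombinations.submodule_def module_vec_def)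
    have A: "\<phi> \<gamma> \<in> carrier_mat n n" by (rule SU_carrier_mat[OF rep_space_SU[OF \<phi> \<gamma>]])
    \<comment> \<open>Being closed under scalars, \<open>W\<close> is also invariant under the untwisted representation.\<close>
    have "inverse (\<xi> \<gamma>) \<cdot>\<^sub>v (twist g \<xi> \<phi> \<gamma> *\<^sub>v w) \<in> W"
      using W sub \<gamma> w by (auto simp: LinearCombinations.submodule_def module_vec_def class_field_def)
    also have "inverse (\<xi> \<gamma>) \<cdot>\<^sub>v (twist g \<xi> \<phi> \<gamma> *\<^sub>v w) = \<phi> \<gamma> *\<^sub>v w"
      using A wc \<gamma> char_nonzero[OF \<gamma>]
      by (intro eq_vecI) (auto simp: twist_apply scalar_prod_def sum_distrib_left field_simps)
    finally show ?thesis .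
  qed
  then show "W = {0\<^sub>v n} \<or> W = carrier_vec n" using W irr by (auto simp: irreducible_rep_def)
qed (rule n_pos)

lemma twist_in_irr_space: "\<phi> \<in> irr_space g n \<Longrightarrow> twist g \<xi> \<phi> \<in> irr_space g n"
  by (simp add: irr_space_def twist_in_rep_space twist_irreducible)

lemma twist_inverse_twist:
  assumes "\<phi> \<in> rep_space g n" shows "twist g (\<lambda>\<gamma>. inverse (\<xi> \<gamma>)) (twist g \<xi> \<phi>) = \<phi>"
proof
  fix \<gamma> show "twist g (\<lambda>\<gamma>. inverse (\<xi> \<gamma>)) (twist g \<xi> \<phi>) \<gamma> = \<phi> \<gamma>"
    using assms char_nonzero[of \<gamma>]
    by (auto simp: twist_def smult_smult_mat one_smult_mat rep_space_def extensional_def)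
qed

lemma twist_twist_inverse:
  assumes "\<phi> \<in> rep_space g n" shows "twist g \<xi> (twist g (\<lambda>\<gamma>. inverse (\<xi> \<gamma>)) \<phi>) = \<phi>"
  using central_character.twist_inverse_twist[OF central_character_inverse assms] by simp

lemma conj_orbit_twist:
  assumes \<phi>: "\<phi> \<in> rep_space g n"
  shows "conj_orbit g n (twist g \<xi> \<phi>) = twist g \<xi> ` conj_orbit g n \<phi>"
proof -
  have "(\<lambda>\<gamma>\<in>carrier (surface_group g). A * twist g \<xi> \<phi> \<gamma> * inv\<^bsub>SU n\<^esub> A) =
      twist g \<xi> (\<lambda>\<gamma>\<in>carrier (surface_group g). A * \<phi> \<gamma> * inv\<^bsub>SU n\<^esub> A)"
    if A: "A \<in> carrier (SU n)" for A
  proof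
    fix \<gamma>
    show "(\<lambda>\<gamma>\<in>carrier (surface_group g). A * twist g \<xi> \<phi> \<gamma> * inv\<^bsub>SU n\<^esub> A) \<gamma> =
      twist g \<xi> (\<lambda>\<gamma>\<in>carrier (surface_group g). A * \<phi> \<gamma> * inv\<^bsub>SU n\<^esub> A) \<gamma>"
      using SU_carrier_mat[OF A] SU_inv_carrier_mat[OF A] SU_carrier_mat[OF rep_space_SU[OF \<phi>], of \<gamma>]
      by (simp add: twist_def mult_smult_distrib[of _ n n _ n] mult_smult_assoc_mat[of _ n n _ n])
  qed
  then show ?thesis
    unfolding conj_orbit_def setcompr_eq_image image_image by (intro image_cong) simp_all
qed

lemma twist_moduli:
  assumes "p \<in> moduli g n" shows "twist g \<xi> ` p \<in> moduli g n"
proof -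
  obtain \<phi> where \<phi>: "\<phi> \<in> irr_space g n" "p = conj_orbit g n \<phi>"
    using assms by (auto simp: moduli_def)
  then have "twist g \<xi> ` p = conj_orbit g n (twist g \<xi> \<phi>)"
    by (simp add: conj_orbit_twist irr_space_def)
  then show ?thesis using twist_in_irr_space[OF \<phi>(1)] by (simp add: moduli_def)
qed

lemma twist_inverse_twist_moduli:
  assumes "p \<in> moduli g n" shows "twist g (\<lambda>\<gamma>. inverse (\<xi> \<gamma>)) ` twist g \<xi> ` p = p"
proof -
  interpret inv: central_character g n "\<lambda>\<gamma>. inverse (\<xi> \<gamma>)" by (rule central_character_inverse)
  obtain \<phi> where "\<phi> \<in> rep_space g n" "p = conj_orbit g n \<phi>"
    using assms by (auto simp: moduli_def irr_space_def)
  then show ?thesis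
    by (simp add: twist_in_rep_space twist_inverse_twist flip: conj_orbit_twist inv.conj_orbit_twist)
qed

lemma continuous_map_twist: "continuous_map (irr_topology g n) (irr_topology g n) (twist g \<xi>)"
proof (rule continuous_map_into_irr_topology)
  fix x i j assume x: "x \<in> gens g" and ij: "i < n" "j < n"
  have "continuous_map (irr_topology g n) euclidean
      (\<lambda>\<phi>. \<xi> (gen_class g x) * \<phi> (gen_class g x) $$ (i, j))"
    using x ij by (intro continuous_map_mult_left_complex continuous_map_irr_entry)
  then show "continuous_map (irr_topology g n) euclidean (\<lambda>\<phi>. twist g \<xi> \<phi> (gen_class g x) $$ (i, j))"
  proof (rule continuous_map_eq)
    fix \<phi> assume "\<phi> \<in> topspace (irr_topology g n)"
    then have "\<phi> (gen_class g x) \<in> carrier_mat n n"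
      using x by (auto simp: topspace_irr_topology irr_space_def intro!: SU_carrier_mat rep_space_SU gen_class_carrier)
    then show "\<xi> (gen_class g x) * \<phi> (gen_class g x) $$ (i, j) = twist g \<xi> \<phi> (gen_class g x) $$ (i, j)"
      using ij by (simp add: twist_apply gen_class_carrier x)
  qed
qed (auto simp: topspace_irr_topology twist_in_irr_space)

lemma continuous_map_twist_moduli:
  "continuous_map (moduli_topology g n) (moduli_topology g n) ((`) (twist g \<xi>))"
  unfolding continuous_map_def topspace_moduli_topology
proof (intro conjI allI impI)
  show "(`) (twist g \<xi>) \<in> moduli g n \<rightarrow> moduli g n" by (simp add: twist_moduli)
  fix V assume "openin (moduli_topology g n) V"
  then have V: "openin (irr_topology g n) {\<phi> \<in> irr_space g n. conj_orbit g n \<phi> \<in> V}"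
    by (simp add: openin_moduli_topology)
  have "conj_orbit g n \<phi> \<in> {p \<in> moduli g n. twist g \<xi> ` p \<in> V} \<longleftrightarrow>
      twist g \<xi> \<phi> \<in> {\<phi> \<in> irr_space g n. conj_orbit g n \<phi> \<in> V}" if "\<phi> \<in> irr_space g n" for \<phi>
    using that conj_orbit_twist[of \<phi>] twist_in_irr_space[of \<phi>]
    by (simp add: irr_space_def moduli_def)
  then have "{\<phi> \<in> irr_space g n. conj_orbit g n \<phi> \<in> {p \<in> moduli g n. twist g \<xi> ` p \<in> V}} =
    {\<phi> \<in> topspace (irr_topology g n). twist g \<xi> \<phi> \<in> {\<phi> \<in> irr_space g n. conj_orbit g n \<phi> \<in> V}}"
    unfolding topspace_irr_topology by (intro Collect_cong conj_cong refl)
  then have "openin (irr_topology g n)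
      {\<phi> \<in> irr_space g n. conj_orbit g n \<phi> \<in> {p \<in> moduli g n. twist g \<xi> ` p \<in> V}}"
    using openin_continuous_map_preimage[OF continuous_map_twist V] by (simp only:)
  then show "openin (moduli_topology g n) {p \<in> moduli g n. twist g \<xi> ` p \<in> V}"
    unfolding openin_moduli_topology by blast
qed

lemma measurable_twist_moduli: "(`) (twist g \<xi>) \<in> measurable (moduli_borel g n) (moduli_borel g n)"
proof (rule measurable_sigma_sets[OF sets_moduli_borel])
  show "{V. openin (moduli_topology g n) V} \<subseteq> Pow (moduli g n)"
    unfolding topspace_moduli_topology[symmetric] by (auto dest: openin_subset)
  show "(`) (twist g \<xi>) \<in> space (moduli_borel g n) \<rightarrow> moduli g n" by (simp add: twist_moduli)
  fix V assume "V \<in> {V. openin (moduli_topology g n) V}"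
  then have "openin (moduli_topology g n) {p \<in> topspace (moduli_topology g n). twist g \<xi> ` p \<in> V}"
    using openin_continuous_map_preimage[OF continuous_map_twist_moduli] by simp
  moreover have "{p \<in> topspace (moduli_topology g n). twist g \<xi> ` p \<in> V} =
      (`) (twist g \<xi>) -` V \<inter> space (moduli_borel g n)"
    by (auto simp: topspace_moduli_topology)
  ultimately show "(`) (twist g \<xi>) -` V \<inter> space (moduli_borel g n) \<in> sets (moduli_borel g n)"
    by (simp add: sets_moduli_borel sigma_sets.Basic)
qed

section \<open>Invariance of the symplectic form and of the volume\<close>

text \<open>Scalars act trivially in the adjoint representation. All cohomological data below depend on
  \<open>\<phi>\<close> only through this action, so none of them changes under the twist.\<close>

lemma Ad_twist:
  assumes "\<phi> \<in> rep_space g n" "\<gamma> \<in> carrier (surface_group g)" "X \<in> carrier_mat n n"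
  shows "Ad n (twist g \<xi> \<phi> \<gamma>) X = Ad n (\<phi> \<gamma>) X"
  using assms root n_pos by (simp add: twist_apply Ad_smult rep_space_SU)

lemma cocycles_twist:
  assumes "\<phi> \<in> rep_space g n" shows "cocycles g n (twist g \<xi> \<phi>) = cocycles g n \<phi>"
proof -
  have "Ad n (twist g \<xi> \<phi> x) (u y) = Ad n (\<phi> x) (u y)"
    if "u \<in> carrier (surface_group g) \<rightarrow>\<^sub>E su n" "x \<in> carrier (surface_group g)"
      "y \<in> carrier (surface_group g)" for u x y
    using that su_carrier_mat by (intro Ad_twist[OF assms]) auto
  then show ?thesis unfolding cocycles_def by (intro Collect_cong conj_cong refl) simp
qed

lemma cohom_class_twist:
  assumes "\<phi> \<in> rep_space g n" shows "cohom_class g n (twist g \<xi> \<phi>) u = cohom_class g n \<phi> u"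
proof -
  have "coboundary g n (twist g \<xi> \<phi>) X = coboundary g n \<phi> X" if "X \<in> su n" for X
    unfolding coboundary_def using Ad_twist[OF assms _ su_carrier_mat[OF that]]
    by (intro restrict_ext) simp
  then show ?thesis
    unfolding cohom_class_def setcompr_eq_image by (intro image_cong) simp_all
qed

lemma H1_basis_twist:
  assumes "\<phi> \<in> rep_space g n" shows "H1_basis g n (twist g \<xi> \<phi>) u \<longleftrightarrow> H1_basis g n \<phi> u"
proof -
  have "cohom_class g n (twist g \<xi> \<phi>) = cohom_class g n \<phi>"
    by (rule ext) (rule cohom_class_twist[OF assms])
  then show ?thesis by (simp add: H1_basis_def H1_def cocycles_twist[OF assms])
qed

lemma ABG_form_twist:
  assumes \<phi>: "\<phi> \<in> rep_space g n"
    and b: "\<And>v \<gamma>. v \<in> b \<Longrightarrow> \<gamma> \<in> carrier (surface_group g) \<Longrightarrow> v \<gamma> \<in> carrier_mat n n"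
  shows "ABG_form g n (twist g \<xi> \<phi>) a b = ABG_form g n \<phi> a b"
proof -
  have "fundamental_eval g (cup_product n (twist g \<xi> \<phi>) u v) = fundamental_eval g (cup_product n \<phi> u v)"
    if "v \<in> b" for u v
    using b[OF that] by (intro fundamental_eval_cong) (simp add: cup_product_def Ad_twist[OF \<phi>])
  then show ?thesis unfolding ABG_form_def by (intro arg_cong[of _ _ The] ext) auto
qed

lemma twist_entry_partial_deriv:
  assumes par: "moduli_parametrization g n U f" and x: "x \<in> U" and i: "i < moduli_dim g n"
    and \<gamma>: "\<gamma> \<in> carrier (surface_group g)" and rs: "r < n" "s < n"
  shows "partial_deriv i (\<lambda>y. twist g \<xi> (f y) \<gamma> $$ (r, s)) x = \<xi> \<gamma> * partial_deriv i (\<lambda>y. f y \<gamma> $$ (r, s)) x"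
proof -
  have U: "openin (euclid (moduli_dim g n)) U" using par by (simp add: moduli_parametrization_def)
  have ev: "\<forall>\<^sub>F t in nhds (x i). \<xi> \<gamma> * f (x(i := t)) \<gamma> $$ (r, s) = twist g \<xi> (f (x(i := t))) \<gamma> $$ (r, s)"
    using eventually_fun_upd_in_open[OF U x i]
  proof eventually_elim
    case (elim t)
    have "f (x(i := t)) \<gamma> \<in> carrier_mat n n"
      using moduli_parametrization_irr[OF par elim] \<gamma>
      by (auto simp: irr_space_def intro: SU_carrier_mat rep_space_SU)
    then show ?case using rs by (simp add: twist_apply[OF \<gamma>])
  qed
  have "((\<lambda>t. f (x(i := t)) \<gamma> $$ (r, s)) has_vector_derivative partial_deriv i (\<lambda>y. f y \<gamma> $$ (r, s)) x) (at (x i))"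
    using moduli_parametrization_entry_differentiable[OF assms]
    by (simp add: partial_deriv_def vector_derivative_works[symmetric])
  then have "((\<lambda>t. \<xi> \<gamma> * f (x(i := t)) \<gamma> $$ (r, s)) has_vector_derivative
      \<xi> \<gamma> * partial_deriv i (\<lambda>y. f y \<gamma> $$ (r, s)) x) (at (x i))"
    by (rule has_vector_derivative_mult_right)
  then have "((\<lambda>t. twist g \<xi> (f (x(i := t))) \<gamma> $$ (r, s)) has_vector_derivative
      \<xi> \<gamma> * partial_deriv i (\<lambda>y. f y \<gamma> $$ (r, s)) x) (at (x i))"
    using ev eventually_nhds_x_imp_x[OF ev] by (subst (asm) has_vector_derivative_cong_ev) auto
  from vector_derivative_at[OF this] show ?thesis
    by (simp only: partial_deriv_def[of i "\<lambda>y. twist g \<xi> (f y) \<gamma> $$ (r, s)"])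
qed

text \<open>The twist multiplies both the derivative of \<open>f\<close> and \<open>f\<close> itself by the constant \<open>\<xi> \<gamma>\<close>, which
  cancels in the logarithmic derivative.\<close>

lemma tangent_cocycle_twist:
  assumes par: "moduli_parametrization g n U f" and x: "x \<in> U" and i: "i < moduli_dim g n"
  shows "tangent_cocycle g n (\<lambda>y. twist g \<xi> (f y)) x i = tangent_cocycle g n f x i"
  unfolding tangent_cocycle_def
proof (rule restrict_ext)
  fix \<gamma> assume \<gamma>: "\<gamma> \<in> carrier (surface_group g)"
  have S: "f x \<gamma> \<in> carrier (SU n)"
    using moduli_parametrization_irr[OF par x] \<gamma> by (auto simp: irr_space_def intro: rep_space_SU)
  have "mat_partial_deriv n i (\<lambda>y. twist g \<xi> (f y) \<gamma>) x = \<xi> \<gamma> \<cdot>\<^sub>m mat_partial_deriv n i (\<lambda>y. f y \<gamma>) x"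
    using twist_entry_partial_deriv[OF par x i \<gamma>]
    by (intro eq_matI) (auto simp: mat_partial_deriv_def)
  then show "mat_partial_deriv n i (\<lambda>y. twist g \<xi> (f y) \<gamma>) x * inv\<^bsub>SU n\<^esub> (twist g \<xi> (f x) \<gamma>) =
      mat_partial_deriv n i (\<lambda>y. f y \<gamma>) x * inv\<^bsub>SU n\<^esub> (f x \<gamma>)"
    using smult_mult_inv_smult[OF root[OF \<gamma>] n_pos S, of "mat_partial_deriv n i (\<lambda>y. f y \<gamma>) x"]
    by (simp add: twist_apply[OF \<gamma>] mat_partial_deriv_def)
qed

text \<open>Injectivity on conjugacy classes survives because the twist by the inverse character undoes
  the twist.\<close>

lemma moduli_parametrization_twist:
  assumes par: "moduli_parametrization g n U f"
  shows "moduli_parametrization g n U (\<lambda>y. twist g \<xi> (f y))"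
  unfolding moduli_parametrization_def
proof (intro conjI ballI)
  interpret inv: central_character g n "\<lambda>\<gamma>. inverse (\<xi> \<gamma>)" by (rule central_character_inverse)
  show U: "openin (euclid (moduli_dim g n)) U" using par by (simp add: moduli_parametrization_def)
  have irr: "f y \<in> irr_space g n" if "y \<in> U" for y using par that by (rule moduli_parametrization_irr)
  then have rep: "f y \<in> rep_space g n" if "y \<in> U" for y using that by (simp add: irr_space_def)
  show "(\<lambda>y. twist g \<xi> (f y)) \<in> U \<rightarrow> irr_space g n" using irr by (simp add: twist_in_irr_space)
  show "smooth_mat_on (moduli_dim g n) n U (\<lambda>y. twist g \<xi> (f y) (gen_class g x))" if x: "x \<in> gens g" for x
    unfolding smooth_mat_on_def
  proof (intro allI impI)
    fix r s k assume rs: "r < n" "s < n"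
    show "C_k_on k (moduli_dim g n) U (\<lambda>y. twist g \<xi> (f y) (gen_class g x) $$ (r, s))"
    proof (rule C_k_on_mult_left[OF U])
      show "C_k_on k (moduli_dim g n) U (\<lambda>y. f y (gen_class g x) $$ (r, s))"
        using par x rs unfolding moduli_parametrization_def smooth_mat_on_def by blast
      show "twist g \<xi> (f y) (gen_class g x) $$ (r, s) = \<xi> (gen_class g x) * f y (gen_class g x) $$ (r, s)"
        if "y \<in> U" for y
        using SU_carrier_mat[OF rep_space_SU[OF rep[OF that] gen_class_carrier[OF x]]] rs x
        by (simp add: twist_apply gen_class_carrier)
    qed
  qed
  show "inj_on (\<lambda>y. conj_orbit g n (twist g \<xi> (f y))) U"
  proof (rule inj_onI)
    fix y z assume yz: "y \<in> U" "z \<in> U"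
      and eq: "conj_orbit g n (twist g \<xi> (f y)) = conj_orbit g n (twist g \<xi> (f z))"
    have "conj_orbit g n (f y) = conj_orbit g n (f z)"
      using arg_cong[OF eq, of "(`) (twist g (\<lambda>\<gamma>. inverse (\<xi> \<gamma>)))"] rep[OF yz(1)] rep[OF yz(2)]
      by (simp add: twist_in_rep_space twist_inverse_twist flip: inv.conj_orbit_twist)
    moreover have "inj_on (\<lambda>y. conj_orbit g n (f y)) U" using par by (simp add: moduli_parametrization_def)
    ultimately show "y = z" using yz by (auto dest: inj_onD)
  qed
  fix y assume y: "y \<in> U"
  have "H1_basis g n (f y) (tangent_cocycle g n f y)" using par y by (simp add: moduli_parametrization_def)
  then show "H1_basis g n (twist g \<xi> (f y)) (tangent_cocycle g n (\<lambda>y. twist g \<xi> (f y)) y)"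
    using H1_basis_cong[OF tangent_cocycle_twist[OF par y]] by (simp add: H1_basis_twist[OF rep[OF y]])
qed

lemma volume_density_twist:
  assumes par: "moduli_parametrization g n U f" and x: "x \<in> U"
  shows "wedge_power (moduli_dim g n div 2) (ABG_form g n (twist g \<xi> (f x)))
      (\<lambda>i. cohom_class g n (twist g \<xi> (f x)) (tangent_cocycle g n (\<lambda>y. twist g \<xi> (f y)) x i)) =
    wedge_power (moduli_dim g n div 2) (ABG_form g n (f x))
      (\<lambda>i. cohom_class g n (f x) (tangent_cocycle g n f x i))"
proof (rule wedge_power_cong)
  fix i j assume "i < 2 * (moduli_dim g n div 2)" "j < 2 * (moduli_dim g n div 2)"
  then have i: "i < moduli_dim g n" and j: "j < moduli_dim g n" by auto
  have rep: "f x \<in> rep_space g n" using moduli_parametrization_irr[OF par x] by (simp add: irr_space_def)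
  have tan: "tangent_cocycle g n f x j \<gamma> \<in> carrier_mat n n" if \<gamma>: "\<gamma> \<in> carrier (surface_group g)" for \<gamma>
    using SU_inv_carrier_mat[OF rep_space_SU[OF rep \<gamma>]] \<gamma>
    by (simp add: tangent_cocycle_def mat_partial_deriv_def mult_carrier_mat[of _ n n])
  have ABG: "ABG_form g n (twist g \<xi> (f x)) a (cohom_class g n (f x) (tangent_cocycle g n f x j)) =
    ABG_form g n (f x) a (cohom_class g n (f x) (tangent_cocycle g n f x j))" for a
    by (rule ABG_form_twist[OF rep]) (erule (1) cohom_class_carrier_mat[OF rep tan, rotated])
  show "ABG_form g n (twist g \<xi> (f x))
      (cohom_class g n (twist g \<xi> (f x)) (tangent_cocycle g n (\<lambda>y. twist g \<xi> (f y)) x i))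
      (cohom_class g n (twist g \<xi> (f x)) (tangent_cocycle g n (\<lambda>y. twist g \<xi> (f y)) x j)) =
    ABG_form g n (f x) (cohom_class g n (f x) (tangent_cocycle g n f x i))
      (cohom_class g n (f x) (tangent_cocycle g n f x j))"
    by (simp add: tangent_cocycle_twist[OF par x] cohom_class_twist[OF rep] i j ABG)
qed

lemma chart_measure_eq_distr:
  assumes par: "moduli_parametrization g n U f"
  shows "\<exists>q\<in>{(U, f). moduli_parametrization g n U f}.
    chart_measure g n (U, f) = distr (chart_measure g n q) (moduli_borel g n) ((`) (twist g \<xi>))"
proof -
  interpret inv: central_character g n "\<lambda>\<gamma>. inverse (\<xi> \<gamma>)" by (rule central_character_inverse)
  \<comment> \<open>The chart that the twist carries to the given one.\<close>
  let ?f = "\<lambda>y. twist g (\<lambda>\<gamma>. inverse (\<xi> \<gamma>)) (f y)"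
  have par': "moduli_parametrization g n U ?f" by (rule inv.moduli_parametrization_twist[OF par])
  have orbit: "conj_orbit g n (?f x) \<in> moduli g n"
    "twist g \<xi> ` conj_orbit g n (?f x) = conj_orbit g n (f x)" if "x \<in> U" for x
  proof -
    show "conj_orbit g n (?f x) \<in> moduli g n"
      using moduli_parametrization_irr[OF par' that] by (simp add: moduli_def)
    have "f x \<in> rep_space g n" using moduli_parametrization_irr[OF par that] by (simp add: irr_space_def)
    then show "twist g \<xi> ` conj_orbit g n (?f x) = conj_orbit g n (f x)"
      by (simp add: inv.twist_in_rep_space twist_twist_inverse flip: conj_orbit_twist)
  qed
  have "distr (chart_measure g n (U, ?f)) (moduli_borel g n) ((`) (twist g \<xi>)) =
      distr (density (restrict_space (Pi\<^sub>M {..<moduli_dim g n} (\<lambda>_. lborel)) U)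
        (\<lambda>x. ennreal (\<bar>wedge_power (moduli_dim g n div 2) (ABG_form g n (?f x))
          (\<lambda>i. cohom_class g n (?f x) (tangent_cocycle g n ?f x i))\<bar> / fact (moduli_dim g n))))
      (moduli_borel g n) (\<lambda>x. twist g \<xi> ` conj_orbit g n (?f x))"
    unfolding chart_measure_def prod.case
    by (rule distr_distr_iso[OF measurable_twist_moduli inv.measurable_twist_moduli])
      (simp_all only: space_moduli_borel twist_inverse_twist_moduli, auto simp: space_restrict_space orbit)
  also have "\<dots> = chart_measure g n (U, f)"
    unfolding chart_measure_def prod.case
    by (rule density_measure_cong_chart) (simp_all only: orbit inv.volume_density_twist[OF par])
  finally have "chart_measure g n (U, f) =
      distr (chart_measure g n (U, ?f)) (moduli_borel g n) ((`) (twist g \<xi>))" by (rule sym)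
  with par' show ?thesis by (metis (mono_tags, lifting) case_prodI mem_Collect_eq)
qed

lemma distr_moduli_volume:
  assumes ne: "{(U, f). moduli_parametrization g n U f} \<noteq> {}"
  shows "distr (moduli_volume g n) (moduli_borel g n) ((`) (twist g \<xi>)) = moduli_volume g n"
proof -
  interpret inv: central_character g n "\<lambda>\<gamma>. inverse (\<xi> \<gamma>)" by (rule central_character_inverse)
  show ?thesis
    unfolding moduli_volume_eq_SUP
  proof (rule distr_SUP_eq_SUP[OF ne sets_chart_measure measurable_twist_moduli inv.measurable_twist_moduli])
    fix p assume p: "p \<in> space (moduli_borel g n)"
    show "twist g \<xi> ` twist g (\<lambda>\<gamma>. inverse (\<xi> \<gamma>)) ` p = p"
      using inv.twist_inverse_twist_moduli[of p] p by (simp add: space_moduli_borel)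
    show "twist g (\<lambda>\<gamma>. inverse (\<xi> \<gamma>)) ` twist g \<xi> ` p = p"
      using twist_inverse_twist_moduli[of p] p by (simp add: space_moduli_borel)
  qed (use chart_measure_eq_distr inv.chart_measure_eq_distr in auto)
qed

lemma integral_moduli_volume_equivariant:
  fixes h :: "rep set \<Rightarrow> complex"
  assumes h: "\<And>p. p \<in> moduli g n \<Longrightarrow> h (twist g \<xi> ` p) = c * h p"
  shows "(\<integral>p. h p \<partial>moduli_volume g n) = c * (\<integral>p. h p \<partial>moduli_volume g n)"
proof (cases "{(U, f). moduli_parametrization g n U f} \<noteq> {} \<and> integrable (moduli_volume g n) h")
  case True
  then have sets: "sets (moduli_volume g n) = sets (moduli_borel g n)"
    unfolding moduli_volume_eq_SUP by (intro sets_SUP sets_chart_measure) auto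
  have "(\<integral>p. h p \<partial>moduli_volume g n) =
      (\<integral>p. h p \<partial>distr (moduli_volume g n) (moduli_borel g n) ((`) (twist g \<xi>)))"
    using True by (subst distr_moduli_volume) auto
  also have "\<dots> = (\<integral>p. h (twist g \<xi> ` p) \<partial>moduli_volume g n)"
  proof (rule integral_distr)
    show "(`) (twist g \<xi>) \<in> measurable (moduli_volume g n) (moduli_borel g n)"
      using measurable_twist_moduli by (simp add: measurable_cong_sets[OF sets refl])
    show "h \<in> borel_measurable (moduli_borel g n)"
      using borel_measurable_integrable[of "moduli_volume g n" h] True
      by (simp add: measurable_cong_sets[OF sets refl])
  qed
  also have "\<dots> = (\<integral>p. c * h p \<partial>moduli_volume g n)"
    using h sets_eq_imp_space_eq[OF sets] by (intro Bochner_Integration.integral_cong) (auto simp: space_moduli_borel)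
  finally show ?thesis by simp
next
  case False
  \<comment> \<open>In the degenerate cases the integral is zero: the supremum over no charts is the bottom
    measure, which lives on the empty space, and the integral of a function that is not integrable
    is zero by convention.\<close>
  then consider "{(U, f). moduli_parametrization g n U f} = {}" | "\<not> integrable (moduli_volume g n) h" by blast
  then have "(\<integral>p. h p \<partial>moduli_volume g n) = 0"
  proof cases
    case 1
    then have "moduli_volume g n = bot" by (simp add: moduli_volume_eq_SUP)
    moreover have "integral\<^sup>L bot h = integral\<^sup>L (bot :: rep set measure) (\<lambda>_. 0)"
      by (rule Bochner_Integration.integral_cong) simp_all
    ultimately show ?thesis by simp
  qed (rule not_integrable_integral_eq)
  then show ?thesis by simp
qed

lemma moduli_trace_twist:
  assumes \<gamma>: "\<gamma> \<in> carrier (surface_group g)" and p: "p \<in> moduli g n"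
  shows "moduli_trace \<gamma> (twist g \<xi> ` p) = \<xi> \<gamma> * moduli_trace \<gamma> p"
proof -
  obtain \<phi> where \<phi>: "\<phi> \<in> rep_space g n" "p = conj_orbit g n \<phi>"
    using p by (auto simp: moduli_def irr_space_def)
  then show ?thesis
    using SU_carrier_mat[OF rep_space_SU[OF \<phi>(1) \<gamma>]]
    by (simp add: moduli_trace_conj_orbit[OF _ \<gamma>] twist_in_rep_space twist_apply[OF \<gamma>] mat_trace_smult
        flip: conj_orbit_twist)
qed

text \<open>The integral of the trace equals \<open>\<xi> \<gamma>\<close> times itself.\<close>

lemma expected_value_moduli_trace_eq_0:
  assumes \<gamma>: "\<gamma> \<in> carrier (surface_group g)" and "\<xi> \<gamma> \<noteq> 1"
  shows "expected_value g n (moduli_trace \<gamma>) = 0"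
  using integral_moduli_volume_equivariant[of "moduli_trace \<gamma>" "\<xi> \<gamma>"] moduli_trace_twist[OF \<gamma>] assms(2)
  by (simp add: expected_value_def)

end

section \<open>Characters detecting elements outside the commutator subgroup\<close>

lemma central_character_class_exponent:
  assumes "n > 0"
  shows "central_character g n (\<lambda>\<gamma>. cis (2 * pi * (class_exponent x \<gamma> / n)))"
proof
  show "cis (2 * pi * (class_exponent x \<gamma> / n)) ^ n = 1" for \<gamma>
    using assms by (simp add: Complex.DeMoivre)
  show "cis (2 * pi * (class_exponent x (\<gamma> \<otimes>\<^bsub>surface_group g\<^esub> \<delta>) / n)) =
      cis (2 * pi * (class_exponent x \<gamma> / n)) * cis (2 * pi * (class_exponent x \<delta> / n))"
    if "\<gamma> \<in> carrier (surface_group g)" "\<delta> \<in> carrier (surface_group g)" for \<gamma> \<delta>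
    using that by (simp add: class_exponent_mult cis_mult add_divide_distrib distrib_left)
qed (rule assms)

lemma cis_fraction_neq_1:
  fixes m :: int and n :: nat
  assumes "m \<noteq> 0" "\<bar>m\<bar> < int n" shows "cis (2 * pi * (m / n)) \<noteq> 1"
proof
  assume "cis (2 * pi * (m / n)) = 1"
  then have "cos (2 * pi * (m / n)) = 1" by (simp add: complex_eq_iff)
  then obtain k :: int where "2 * pi * (m / n) = of_int k * 2 * pi" using cos_one_2pi_int by blast
  then have "real_of_int m = of_int (k * int n)" using assms by (simp add: field_simps)
  then have "m = k * int n" by linarith
  then show False using assms dvd_imp_le_int[of m "int n"] by auto
qed

theorem proposition1p5:
  fixes g :: nat and \<gamma> :: "word set"
  assumes "g \<ge> 2"
    and "\<gamma> \<in> carrier (surface_group g)"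
    and "\<gamma> \<notin> derived (surface_group g) (carrier (surface_group g))"
  shows "\<exists>n0. \<forall>n\<ge>n0. expected_value g n (moduli_trace \<gamma>) = 0"
proof -
  obtain x where x: "class_exponent x \<gamma> \<noteq> 0" using class_exponent_nonzero[OF assms(2,3)] .
  \<comment> \<open>For \<open>n\<close> beyond the exponent \<open>m\<close> of \<open>x\<close> in \<open>\<gamma>\<close>, the character sending \<open>x\<close> to a primitive
    \<open>n\<close>-th root of unity is nontrivial at \<open>\<gamma>\<close>, because \<open>n\<close> does not divide \<open>m\<close>.\<close>
  have "expected_value g n (moduli_trace \<gamma>) = 0" if n: "nat \<bar>class_exponent x \<gamma>\<bar> + 1 \<le> n" for n
  proof -
    interpret central_character g n "\<lambda>\<gamma>. cis (2 * pi * (class_exponent x \<gamma> / n))"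
      using n by (intro central_character_class_exponent) simp
    show ?thesis
      using cis_fraction_neq_1[OF x, of n] n assms(2) by (intro expected_value_moduli_trace_eq_0) auto
  qed
  then show ?thesis by blast
qed

end
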